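(* Let $d\ge 2$ be an integer. There exists a constant $c>0$ depending only on $d$ such that for every prime power $q$, every set of points $A\subset\mathbb{F}_q^d$ and every set $R$ of rigid motions in $\mathbb{F}_q^d$, \[\left\vert \bigcup_{r\in R}\phi_r(A)\right\vert\ \ge\ c\,\min\left\lbrace q^d,\ \frac{|A||R|}{q^d\,|O(d-1)|}\right\rbrace .\]
   Context: $\mathbb{F}_q$ is the finite field of order $q$. $O(n)$ is the group of $n\times n$ orthogonal matrices over $\mathbb{F}_q$ ($g^Tg=I$). A rigid motion in $\mathbb{F}_q^d$ is a pair $r=(g,z)\in O(d)\times\mathbb{F}_q^d$, acting by $\phi_r(x):=gx+z$.
   Formalization: The formal theorem covers only odd prime powers q, since for even q the inequality is false (every orthogonal g then preserves x_1+...+x_d); the field F_q is taken with a set of natural numbers as its elements, which loses nothing up to isomorphism. *)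

theory Defs
  imports Complex_Main "HOL-Library.FuncSet" "HOL-Algebra.Ring"
begin

(* The field is a locale-style record, so that it can be quantified inside a formula.  Vectors
   and matrices are extensional functions on the index set {..<n}: equality is equality of
   entries, and card counts them correctly. *)

definition vecs :: "('a, 'm) ring_scheme \<Rightarrow> nat \<Rightarrow> (nat \<Rightarrow> 'a) set" where
  "vecs F n = {..<n} \<rightarrow>\<^sub>E carrier F"

definition mats :: "('a, 'm) ring_scheme \<Rightarrow> nat \<Rightarrow> (nat \<Rightarrow> nat \<Rightarrow> 'a) set" where
  "mats F n = {..<n} \<rightarrow>\<^sub>E ({..<n} \<rightarrow>\<^sub>E carrier F)"

definition mat_id :: "('a, 'm) ring_scheme \<Rightarrow> nat \<Rightarrow> (nat \<Rightarrow> nat \<Rightarrow> 'a)" where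
  "mat_id F n = (\<lambda>i\<in>{..<n}. \<lambda>j\<in>{..<n}. if i = j then \<one>\<^bsub>F\<^esub> else \<zero>\<^bsub>F\<^esub>)"

definition mat_transpose :: "nat \<Rightarrow> (nat \<Rightarrow> nat \<Rightarrow> 'a) \<Rightarrow> (nat \<Rightarrow> nat \<Rightarrow> 'a)" where
  "mat_transpose n g = (\<lambda>i\<in>{..<n}. \<lambda>j\<in>{..<n}. g j i)"

definition mat_mult ::
  "('a, 'm) ring_scheme \<Rightarrow> nat \<Rightarrow> (nat \<Rightarrow> nat \<Rightarrow> 'a) \<Rightarrow> (nat \<Rightarrow> nat \<Rightarrow> 'a) \<Rightarrow> (nat \<Rightarrow> nat \<Rightarrow> 'a)" where
  "mat_mult F n g h =
     (\<lambda>i\<in>{..<n}. \<lambda>j\<in>{..<n}. \<Oplus>\<^bsub>F\<^esub>k\<in>{..<n}. g i k \<otimes>\<^bsub>F\<^esub> h k j)"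

definition mat_vec ::
  "('a, 'm) ring_scheme \<Rightarrow> nat \<Rightarrow> (nat \<Rightarrow> nat \<Rightarrow> 'a) \<Rightarrow> (nat \<Rightarrow> 'a) \<Rightarrow> (nat \<Rightarrow> 'a)" where
  "mat_vec F n g x = (\<lambda>i\<in>{..<n}. \<Oplus>\<^bsub>F\<^esub>k\<in>{..<n}. g i k \<otimes>\<^bsub>F\<^esub> x k)"

definition vec_plus ::
  "('a, 'm) ring_scheme \<Rightarrow> nat \<Rightarrow> (nat \<Rightarrow> 'a) \<Rightarrow> (nat \<Rightarrow> 'a) \<Rightarrow> (nat \<Rightarrow> 'a)" where
  "vec_plus F n x y = (\<lambda>i\<in>{..<n}. x i \<oplus>\<^bsub>F\<^esub> y i)"

definition orth :: "('a, 'm) ring_scheme \<Rightarrow> nat \<Rightarrow> (nat \<Rightarrow> nat \<Rightarrow> 'a) set" where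
  "orth F n = {g \<in> mats F n. mat_mult F n (mat_transpose n g) g = mat_id F n}"

definition rigid_motions ::
  "('a, 'm) ring_scheme \<Rightarrow> nat \<Rightarrow> ((nat \<Rightarrow> nat \<Rightarrow> 'a) \<times> (nat \<Rightarrow> 'a)) set" where
  "rigid_motions F d = orth F d \<times> vecs F d"

definition rigid_map ::
  "('a, 'm) ring_scheme \<Rightarrow> nat \<Rightarrow> (nat \<Rightarrow> nat \<Rightarrow> 'a) \<times> (nat \<Rightarrow> 'a) \<Rightarrow> (nat \<Rightarrow> 'a) \<Rightarrow> (nat \<Rightarrow> 'a)" where
  "rigid_map F d r x = vec_plus F d (mat_vec F d (fst r) x) (snd r)"

end

theory Submission
  imports Defs "HOL-Algebra.Multiplicative_Group"
begin

text \<open>Fix a field with an odd number \<open>q\<close> of elements, and consider vectors of length \<open>d\<close> over it.  For an orthogonal map \<open>f\<close> and a translation \<open>z\<close> let \<open>N f z\<close> be the number of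
  \<open>a \<in> A\<close> with \<open>f a + z \<in> B\<close>.  On average over all rigid motions \<open>N\<close> equals
  \<open>|A| |B| / q^d\<close>, and the idea of the proof is that its variance is small.  Apply this with
  \<open>B\<close> the union of the images of \<open>A\<close>: every motion in \<open>R\<close> has \<open>N = |A|\<close>, which is at least
  twice the average as soon as \<open>|B| \<le> q^d / 2\<close>, so a small variance leaves room for few motions
  only.  This gives the bound on \<open>|R|\<close> in \<open>card_rigid_images_ge\<close>.

  The variance is computed with a nontrivial additive character of the field, which exists
  because the quotient of a finite abelian group by a maximal proper subgroup is cyclic
  (\<open>exists_nontrivial_character\<close>).  For a fixed \<open>f\<close>, Parseval's identity in \<open>z\<close> turns the
  variance into a sum, over nonzero frequencies \<open>m\<close>, of the products of the squared Fourier
  coefficients of \<open>A\<close> at \<open>m\<close> and of \<open>B\<close> at \<open>f m\<close>.  If at most \<open>K\<close> isometries send a given nonzero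
  vector to a given vector, then summing over \<open>f\<close> decouples the two factors at the cost of a
  factor \<open>K\<close>, and Parseval applies once more to each of them (\<open>incidence_variance_le\<close>).

  It remains to see that \<open>K\<close> may be taken as a constant times \<open>|O(d - 1)|\<close>.  Both numbers are
  compared with \<open>\<Prod>k<d - 1. q ^ k\<close>, the order of magnitude of an orthogonal group in
  dimension \<open>d - 1\<close>.

  For the upper bound, the isometries that send \<open>m\<close> to a given vector are no more numerous than
  the fixator of \<open>m\<close>.  Now fix basis vectors one at a time.  Each of them has an orbit inside a
  quadric in an affine space; the quadric does not fill that space, so it meets the lines of some
  direction in at most two points each, and the index of the smaller fixator is at most \<open>2 q^l\<close>
  with \<open>l = d - 2, ..., 0\<close> (\<open>card_fixator_frame_le\<close>).  This covers isotropic \<open>m\<close> as well, and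
  avoids Witt's theorem.

  For the lower bound, the reflections in the vectors \<open>(k, 1)\<close> move the last basis vector to
  pairwise distinct points, so that composing them with the isometries that fix this vector
  produces at least \<open>q^n / 3\<close> times as many isometries in dimension \<open>n + 1\<close> as there are in
  dimension \<open>n\<close> (\<open>card_isometries_Suc_ge\<close>).\<close>

section \<open>Vectors over a finite field of odd order\<close>

definition smul :: "('a, 'm) ring_scheme \<Rightarrow> nat \<Rightarrow> 'a \<Rightarrow> (nat \<Rightarrow> 'a) \<Rightarrow> (nat \<Rightarrow> 'a)" where
  "smul F n t x = (\<lambda>i\<in>{..<n}. t \<otimes>\<^bsub>F\<^esub> x i)"

definition unit_vec :: "('a, 'm) ring_scheme \<Rightarrow> nat \<Rightarrow> nat \<Rightarrow> (nat \<Rightarrow> 'a)" where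
  "unit_vec F n j = (\<lambda>i\<in>{..<n}. if i = j then \<one>\<^bsub>F\<^esub> else \<zero>\<^bsub>F\<^esub>)"

definition dot :: "('a, 'm) ring_scheme \<Rightarrow> nat \<Rightarrow> (nat \<Rightarrow> 'a) \<Rightarrow> (nat \<Rightarrow> 'a) \<Rightarrow> 'a" where
  "dot F n x y = (\<Oplus>\<^bsub>F\<^esub>k\<in>{..<n}. x k \<otimes>\<^bsub>F\<^esub> y k)"

lemma (in abelian_monoid) finsum_swap:
  assumes "finite A" "finite B" "\<And>i j. i \<in> A \<Longrightarrow> j \<in> B \<Longrightarrow> f i j \<in> carrier G"
  shows "(\<Oplus>i\<in>A. \<Oplus>j\<in>B. f i j) = (\<Oplus>j\<in>B. \<Oplus>i\<in>A. f i j)"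
  using assms
proof (induction A rule: finite_induct)
  case empty
  then show ?case by simp
next
  case (insert a A)
  have "(\<Oplus>i\<in>insert a A. \<Oplus>j\<in>B. f i j) = (\<Oplus>j\<in>B. f a j) \<oplus> (\<Oplus>j\<in>B. \<Oplus>i\<in>A. f i j)"
    using insert by (subst finsum_insert) (auto intro!: finsum_closed)
  also have "\<dots> = (\<Oplus>j\<in>B. f a j \<oplus> (\<Oplus>i\<in>A. f i j))"
    using insert by (intro finsum_addf[symmetric]) (auto intro!: finsum_closed)
  also have "\<dots> = (\<Oplus>j\<in>B. \<Oplus>i\<in>insert a A. f i j)"
    using insert by (intro finsum_cong') (auto intro!: finsum_closed)
  finally show ?case .
qed

locale odd_finite_field = field F for F :: "('a, 'm) ring_scheme" (structure) +
  assumes finite_carrier: "finite (carrier F)"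
      and odd_card: "odd (card (carrier F))"
begin

abbreviation q :: nat where "q \<equiv> card (carrier F)"

lemma q_ge_3: "q \<ge> 3"
proof -
  have "{\<zero>, \<one>} \<subseteq> carrier F" by auto
  then have "card {\<zero>, \<one>} \<le> q" by (rule card_mono[OF finite_carrier])
  then have "2 \<le> q" using zero_not_one by simp
  moreover have "q \<noteq> 2" using odd_card by auto
  ultimately show ?thesis by linarith
qed

lemma two_neq_zero: "\<one> \<oplus> \<one> \<noteq> \<zero>"
proof
  assume *: "\<one> \<oplus> \<one> = \<zero>"
  \<comment> \<open>If 1 + 1 = 0, then q times 1 is 1 because q is odd, but it is 0 by Lagrange.\<close>
  obtain k where k: "q = Suc (2 * k)"
    using odd_card by (metis oddE Suc_eq_plus1)
  have "[q] \<cdot> \<one> = \<zero>"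
    using group.pow_order_eq_1[OF a_group, of \<one>] by (simp add: order_def add_pow_def)
  moreover have "[(2 * k)] \<cdot> \<one> = \<zero>"
    by (induction k) (auto simp: * add.m_assoc)
  ultimately show False using k by simp
qed

lemma double_eq_zero:
  assumes "x \<in> carrier F" "x \<oplus> x = \<zero>"
  shows "x = \<zero>"
proof -
  have "(\<one> \<oplus> \<one>) \<otimes> x = \<zero>" using assms by (simp add: l_distr)
  then show ?thesis using two_neq_zero assms integral by blast
qed

lemma finite_vecs: "finite (vecs F n)"
  unfolding vecs_def by (intro finite_PiE) (auto simp: finite_carrier)

lemma card_vecs: "card (vecs F n) = q ^ n"
  unfolding vecs_def by (simp add: card_PiE)

lemma vecs_nth: "x \<in> vecs F n \<Longrightarrow> i < n \<Longrightarrow> x i \<in> carrier F"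
  unfolding vecs_def by auto

lemma vecs_eqI:
  assumes "x \<in> vecs F n" "y \<in> vecs F n" "\<And>i. i < n \<Longrightarrow> x i = y i"
  shows "x = y"
  using assms unfolding vecs_def by (auto intro: PiE_ext)

lemma vec_plus_closed: "x \<in> vecs F n \<Longrightarrow> y \<in> vecs F n \<Longrightarrow> vec_plus F n x y \<in> vecs F n"
  unfolding vec_plus_def vecs_def by (auto intro!: a_closed)

lemma smul_closed: "t \<in> carrier F \<Longrightarrow> x \<in> vecs F n \<Longrightarrow> smul F n t x \<in> vecs F n"
  unfolding smul_def vecs_def by (auto intro!: m_closed)

lemma unit_vec_closed: "unit_vec F n j \<in> vecs F n"
  unfolding unit_vec_def vecs_def by auto

lemmas vec_closed = vec_plus_closed smul_closed unit_vec_closed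

lemma vec_plus_nth: "i < n \<Longrightarrow> vec_plus F n x y i = x i \<oplus> y i"
  by (simp add: vec_plus_def)

lemma smul_nth: "i < n \<Longrightarrow> smul F n t x i = t \<otimes> x i"
  by (simp add: smul_def)

lemma unit_vec_nth: "i < n \<Longrightarrow> unit_vec F n j i = (if i = j then \<one> else \<zero>)"
  by (simp add: unit_vec_def)

lemmas vec_nth = vec_plus_nth smul_nth unit_vec_nth

lemma dot_closed [simp]: "x \<in> vecs F n \<Longrightarrow> y \<in> vecs F n \<Longrightarrow> dot F n x y \<in> carrier F"
  unfolding dot_def by (intro finsum_closed) (auto simp: vecs_nth)

lemma dot_comm: "x \<in> vecs F n \<Longrightarrow> y \<in> vecs F n \<Longrightarrow> dot F n x y = dot F n y x"
  unfolding dot_def by (intro finsum_cong') (auto simp: vecs_nth m_comm)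

lemma dot_plus_left:
  assumes "x \<in> vecs F n" "y \<in> vecs F n" "z \<in> vecs F n"
  shows "dot F n (vec_plus F n x y) z = dot F n x z \<oplus> dot F n y z"
proof -
  have "dot F n (vec_plus F n x y) z = (\<Oplus>k\<in>{..<n}. x k \<otimes> z k \<oplus> y k \<otimes> z k)"
    unfolding dot_def using assms
    by (intro finsum_cong') (auto simp: vecs_nth vec_nth l_distr)
  also have "\<dots> = dot F n x z \<oplus> dot F n y z"
    unfolding dot_def using assms by (intro finsum_addf) (auto simp: vecs_nth)
  finally show ?thesis .
qed

lemma dot_smul_left:
  assumes "x \<in> vecs F n" "t \<in> carrier F" "z \<in> vecs F n"
  shows "dot F n (smul F n t x) z = t \<otimes> dot F n x z"
proof -
  have "dot F n (smul F n t x) z = (\<Oplus>k\<in>{..<n}. t \<otimes> (x k \<otimes> z k))"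
    unfolding dot_def using assms
    by (intro finsum_cong') (auto simp: vecs_nth vec_nth m_assoc)
  also have "\<dots> = t \<otimes> dot F n x z"
    unfolding dot_def using assms by (intro finsum_rdistr[symmetric]) (auto simp: vecs_nth)
  finally show ?thesis .
qed

lemma dot_plus_right:
  assumes "x \<in> vecs F n" "y \<in> vecs F n" "z \<in> vecs F n"
  shows "dot F n z (vec_plus F n x y) = dot F n z x \<oplus> dot F n z y"
  using assms dot_plus_left[OF assms] by (simp add: dot_comm[of z] vec_closed)

lemma dot_smul_right:
  assumes "x \<in> vecs F n" "t \<in> carrier F" "z \<in> vecs F n"
  shows "dot F n z (smul F n t x) = t \<otimes> dot F n z x"
  using assms dot_smul_left[OF assms] by (simp add: dot_comm[of z] vec_closed)

lemmas dot_bilinear = dot_plus_left dot_plus_right dot_smul_left dot_smul_right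

lemma dot_unit_vec:
  assumes "x \<in> vecs F n" "j < n"
  shows "dot F n x (unit_vec F n j) = x j"
proof -
  have "dot F n x (unit_vec F n j) = (\<Oplus>k\<in>{..<n}. if j = k then x k else \<zero>)"
    unfolding dot_def using assms by (intro finsum_cong') (auto simp: vecs_nth vec_nth)
  also have "\<dots> = x j" using assms by (intro finsum_singleton) (auto simp: vecs_nth)
  finally show ?thesis .
qed

lemma dot_Suc:
  assumes "x \<in> vecs F (Suc n)" "y \<in> vecs F (Suc n)"
  shows "dot F (Suc n) x y = dot F n x y \<oplus> x n \<otimes> y n"
proof -
  have "dot F (Suc n) x y = x n \<otimes> y n \<oplus> dot F n x y"
    unfolding dot_def lessThan_Suc using assms
    by (intro finsum_insert) (auto simp: vecs_nth)
  moreover have "dot F n x y \<in> carrier F"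
    unfolding dot_def by (intro finsum_closed) (use assms in \<open>auto simp: vecs_nth\<close>)
  ultimately show ?thesis
    using assms by (simp add: a_comm vecs_nth)
qed

lemma dot_cong:
  assumes "\<And>i. i < n \<Longrightarrow> x i = x' i" "\<And>i. i < n \<Longrightarrow> y i = y' i"
    "x' \<in> vecs F n" "y' \<in> vecs F n"
  shows "dot F n x y = dot F n x' y'"
  unfolding dot_def using assms by (intro finsum_cong') (auto simp: vecs_nth)

lemma vecs_eqI_dot:
  assumes "x \<in> vecs F n" "y \<in> vecs F n" "\<And>z. z \<in> vecs F n \<Longrightarrow> dot F n x z = dot F n y z"
  shows "x = y"
  using assms by (metis dot_unit_vec unit_vec_closed vecs_eqI)

lemma bij_betw_vec_plus:
  assumes "x \<in> vecs F n"
  shows "bij_betw (vec_plus F n x) (vecs F n) (vecs F n)"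
proof -
  have "inj_on (vec_plus F n x) (vecs F n)"
  proof (rule inj_onI)
    fix y z assume *: "y \<in> vecs F n" "z \<in> vecs F n" "vec_plus F n x y = vec_plus F n x z"
    then have "x i \<oplus> y i = x i \<oplus> z i" if "i < n" for i
      using that by (metis vec_plus_nth)
    then show "y = z" using * assms by (intro vecs_eqI[of y n z]) (auto simp: vecs_nth)
  qed
  moreover have "vec_plus F n x ` vecs F n \<subseteq> vecs F n" using assms by (auto simp: vec_closed)
  ultimately show ?thesis
    by (simp add: bij_betw_def endo_inj_surj finite_vecs)
qed

section \<open>Quadrics and lines\<close>

lemma card_quadratic_roots_le_2:
  assumes [simp]: "a \<in> carrier F" "b \<in> carrier F" "c \<in> carrier F" and "a \<noteq> \<zero> \<or> b \<noteq> \<zero>"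
  shows "card {t \<in> carrier F. a \<otimes> t \<otimes> t \<oplus> b \<otimes> t \<oplus> c = \<zero>} \<le> 2"
proof (cases "\<exists>s\<in>carrier F. a \<otimes> s \<otimes> s \<oplus> b \<otimes> s \<oplus> c = \<zero>")
  case False
  then have none: "{t \<in> carrier F. a \<otimes> t \<otimes> t \<oplus> b \<otimes> t \<oplus> c = \<zero>} = {}" by blast
  show ?thesis unfolding none by simp
next
  case True
  then obtain s where s: "s \<in> carrier F" "a \<otimes> s \<otimes> s \<oplus> b \<otimes> s \<oplus> c = \<zero>" by auto
  have factor: "t = s \<or> a \<otimes> (t \<oplus> s) \<oplus> b = \<zero>"
    if t: "t \<in> carrier F" "a \<otimes> t \<otimes> t \<oplus> b \<otimes> t \<oplus> c = \<zero>" for t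
  proof -
    have "(t \<ominus> s) \<otimes> (a \<otimes> (t \<oplus> s) \<oplus> b) =
        (a \<otimes> t \<otimes> t \<oplus> b \<otimes> t \<oplus> c) \<ominus> (a \<otimes> s \<otimes> s \<oplus> b \<otimes> s \<oplus> c)"
      using assms(1-3) s(1) t(1) by algebra
    also have "\<dots> = \<zero>" by (simp add: s t)
    finally have "t \<ominus> s = \<zero> \<or> a \<otimes> (t \<oplus> s) \<oplus> b = \<zero>"
      using s(1) t(1) by (intro integral) auto
    then show ?thesis using s(1) t(1) by (auto simp: r_right_minus_eq)
  qed
  have "{t \<in> carrier F. a \<otimes> t \<otimes> t \<oplus> b \<otimes> t \<oplus> c = \<zero>}
      \<subseteq> insert s {t \<in> carrier F. a \<otimes> (t \<oplus> s) \<oplus> b = \<zero>}"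
    using factor by auto
  moreover have "card {t \<in> carrier F. a \<otimes> (t \<oplus> s) \<oplus> b = \<zero>} \<le> 1"
  proof -
    have "t = t'" if t: "t \<in> carrier F" "a \<otimes> (t \<oplus> s) \<oplus> b = \<zero>"
      "t' \<in> carrier F" "a \<otimes> (t' \<oplus> s) \<oplus> b = \<zero>" for t t'
    proof -
      have "a \<noteq> \<zero>" using assms(4) t s(1) by auto
      have "a \<otimes> (t \<ominus> t') = (a \<otimes> (t \<oplus> s) \<oplus> b) \<ominus> (a \<otimes> (t' \<oplus> s) \<oplus> b)"
        using assms(1-3) s(1) t(1,3) by algebra
      then have "a \<otimes> (t \<ominus> t') = \<zero>" by (simp add: t)
      then have "t \<ominus> t' = \<zero>" using \<open>a \<noteq> \<zero>\<close> integral t by (metis assms(1) minus_closed)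
      then show ?thesis using t by (auto simp: r_right_minus_eq)
    qed
    then show ?thesis by (auto simp: card_le_Suc0_iff_eq finite_carrier)
  qed
  moreover have "finite {t \<in> carrier F. a \<otimes> (t \<oplus> s) \<oplus> b = \<zero>}"
    using finite_carrier by simp
  moreover from this have "card (insert s {t \<in> carrier F. a \<otimes> (t \<oplus> s) \<oplus> b = \<zero>})
      \<le> Suc (card {t \<in> carrier F. a \<otimes> (t \<oplus> s) \<oplus> b = \<zero>})"
    by (simp add: card_insert_if)
  moreover have "card {t \<in> carrier F. a \<otimes> t \<otimes> t \<oplus> b \<otimes> t \<oplus> c = \<zero>}
      \<le> card (insert s {t \<in> carrier F. a \<otimes> (t \<oplus> s) \<oplus> b = \<zero>})"
    using calculation by (intro card_mono) auto
  ultimately show ?thesis by linarith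
qed

text \<open>Double counting of the pairs of a point of \<open>W\<close> and a step \<open>t\<close> along \<open>u\<close> that lands in \<open>Q\<close>:
  each of the \<open>q\<close> steps permutes \<open>W\<close> and therefore contributes \<open>card Q\<close>.  Counting pairs instead
  of lines makes it unnecessary to choose representatives of the lines.\<close>

lemma card_le_2_per_line:
  assumes W: "W \<subseteq> vecs F n" and Q: "Q \<subseteq> W" and u: "u \<in> vecs F n"
    and shift: "\<And>w t. w \<in> W \<Longrightarrow> t \<in> carrier F \<Longrightarrow> vec_plus F n w (smul F n t u) \<in> W"
    and two: "\<And>w. w \<in> W \<Longrightarrow>
       card {t \<in> carrier F. vec_plus F n w (smul F n t u) \<in> Q} \<le> 2"
  shows "q * card Q \<le> 2 * card W"
proof -
  let ?s = "\<lambda>t w. vec_plus F n w (smul F n t u)"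
  have fW: "finite W" using W finite_vecs finite_subset by blast
  have "card {w \<in> W. ?s t w \<in> Q} = card Q" if t: "t \<in> carrier F" for t
  proof -
    have inj: "inj_on (?s t) W"
    proof (rule inj_onI)
      fix x y assume *: "x \<in> W" "y \<in> W" "?s t x = ?s t y"
      then have "x i \<oplus> t \<otimes> u i = y i \<oplus> t \<otimes> u i" if "i < n" for i
        using that by (metis vec_plus_nth smul_nth)
      moreover have "x \<in> vecs F n" "y \<in> vecs F n" using * W by auto
      ultimately show "x = y" using u t
        by (intro vecs_eqI[of x n y]) (auto simp: vecs_nth)
    qed
    moreover have "?s t ` W \<subseteq> W" using shift t by auto
    ultimately have "?s t ` W = W" using fW by (simp add: endo_inj_surj)
    have img: "?s t ` {w \<in> W. ?s t w \<in> Q} = Q"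
    proof
      show "Q \<subseteq> ?s t ` {w \<in> W. ?s t w \<in> Q}"
      proof
        fix y assume "y \<in> Q"
        then have "y \<in> ?s t ` W" using Q \<open>?s t ` W = W\<close> by auto
        then show "y \<in> ?s t ` {w \<in> W. ?s t w \<in> Q}" using \<open>y \<in> Q\<close> by auto
      qed
    qed auto
    have "inj_on (?s t) {w \<in> W. ?s t w \<in> Q}"
      by (rule inj_on_subset[OF inj]) auto
    from card_image[OF this] show ?thesis unfolding img by (rule sym)
  qed
  then have "q * card Q = (\<Sum>t\<in>carrier F. card {w \<in> W. ?s t w \<in> Q})" by simp
  also have "\<dots> = (\<Sum>t\<in>carrier F. \<Sum>w\<in>W. if ?s t w \<in> Q then 1 else 0)"
    by (intro sum.cong refl) (simp add: fW sum.If_cases Int_def)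
  also have "\<dots> = (\<Sum>w\<in>W. \<Sum>t\<in>carrier F. if ?s t w \<in> Q then 1 else 0)"
    by (rule sum.swap)
  also have "\<dots> = (\<Sum>w\<in>W. card {t \<in> carrier F. ?s t w \<in> Q})"
    by (intro sum.cong refl) (simp add: finite_carrier sum.If_cases Int_def)
  also have "\<dots> \<le> (\<Sum>w\<in>W. 2)" by (intro sum_mono two)
  finally show ?thesis by simp
qed

lemma dot_line:
  assumes "w \<in> vecs F n" "u \<in> vecs F n" "t \<in> carrier F"
  shows "dot F n (vec_plus F n w (smul F n t u)) (vec_plus F n w (smul F n t u)) =
    dot F n u u \<otimes> t \<otimes> t \<oplus> (dot F n u w \<oplus> dot F n u w) \<otimes> t \<oplus> dot F n w w"
proof -
  have *: "a \<oplus> t \<otimes> b \<oplus> t \<otimes> (b \<oplus> t \<otimes> c) = c \<otimes> t \<otimes> t \<oplus> (b \<oplus> b) \<otimes> t \<oplus> a"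
    if "a \<in> carrier F" "b \<in> carrier F" "c \<in> carrier F" for a b c
    using assms(3) that by algebra
  show ?thesis using *[of "dot F n w w" "dot F n u w" "dot F n u u"] assms
    by (simp add: dot_bilinear vec_closed dot_comm[of w n u])
qed

text \<open>Along the line the equation is quadratic in \<open>t\<close>, with coefficients \<open>u \<bullet> u\<close> and \<open>2 (u \<bullet> w)\<close>.
  That 2 is invertible enters through the second one.\<close>

lemma card_quadric_line_le_2:
  assumes "w \<in> vecs F n" "u \<in> vecs F n" "s \<in> carrier F"
    and "dot F n u u \<noteq> \<zero> \<or> dot F n u w \<noteq> \<zero>"
  shows "card {t \<in> carrier F.
    dot F n (vec_plus F n w (smul F n t u)) (vec_plus F n w (smul F n t u)) = s} \<le> 2"
proof -
  have "{t \<in> carrier F.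
      dot F n (vec_plus F n w (smul F n t u)) (vec_plus F n w (smul F n t u)) = s}
    = {t \<in> carrier F. dot F n u u \<otimes> t \<otimes> t \<oplus> (dot F n u w \<oplus> dot F n u w) \<otimes> t
         \<oplus> (dot F n w w \<ominus> s) = \<zero>}"
    (is "?L = ?R")
  proof -
    have "a \<oplus> b \<oplus> c = s \<longleftrightarrow> a \<oplus> b \<oplus> (c \<ominus> s) = \<zero>"
      if "a \<in> carrier F" "b \<in> carrier F" "c \<in> carrier F" for a b c
    proof -
      have "a \<oplus> b \<oplus> (c \<ominus> s) = (a \<oplus> b \<oplus> c) \<ominus> s" using assms(3) that by algebra
      then show ?thesis using assms(3) that by (simp add: r_right_minus_eq)
    qed
    then show ?thesis using assms(1-3) by (simp add: dot_line cong: conj_cong)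
  qed
  moreover have "card ?R \<le> 2"
    by (intro card_quadratic_roots_le_2) (use assms double_eq_zero[of "dot F n u w"] in auto)
  ultimately show ?thesis by simp
qed

end

section \<open>Isometries and their fixators\<close>

text \<open>Only the preservation of the dot product is required.  Linearity would follow from it, but
  every argument below uses just the identity \<open>f x \<bullet> f y = x \<bullet> y\<close> and its consequence that
  \<open>f\<close> is a bijection.\<close>

definition isometries :: "('a, 'm) ring_scheme \<Rightarrow> nat \<Rightarrow> ((nat \<Rightarrow> 'a) \<Rightarrow> (nat \<Rightarrow> 'a)) set" where
  "isometries F n = {f \<in> vecs F n \<rightarrow>\<^sub>E vecs F n.
     \<forall>x\<in>vecs F n. \<forall>y\<in>vecs F n. dot F n (f x) (f y) = dot F n x y}"

definition fixator :: "('a, 'm) ring_scheme \<Rightarrow> nat \<Rightarrow> (nat \<Rightarrow> 'a) set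
    \<Rightarrow> ((nat \<Rightarrow> 'a) \<Rightarrow> (nat \<Rightarrow> 'a)) set" where
  "fixator F n S = {f \<in> isometries F n. \<forall>x\<in>S. f x = x}"

context odd_finite_field
begin

lemma isometry_closed: "f \<in> isometries F n \<Longrightarrow> x \<in> vecs F n \<Longrightarrow> f x \<in> vecs F n"
  unfolding isometries_def by auto

lemma isometry_dot:
  "f \<in> isometries F n \<Longrightarrow> x \<in> vecs F n \<Longrightarrow> y \<in> vecs F n \<Longrightarrow> dot F n (f x) (f y) = dot F n x y"
  unfolding isometries_def by auto

lemma isometry_eqI:
  assumes "f \<in> isometries F n" "g \<in> isometries F n" "\<And>x. x \<in> vecs F n \<Longrightarrow> f x = g x"
  shows "f = g"
  using assms unfolding isometries_def by (intro PiE_ext[of f "vecs F n" "\<lambda>_. vecs F n" g]) blast+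

lemma finite_isometries: "finite (isometries F n)"
  by (rule finite_subset[of _ "vecs F n \<rightarrow>\<^sub>E vecs F n"])
     (use finite_PiE[OF finite_vecs, of n "\<lambda>_. vecs F n"] finite_vecs in \<open>auto simp: isometries_def\<close>)

lemma isometry_bij:
  assumes "f \<in> isometries F n"
  shows "bij_betw f (vecs F n) (vecs F n)"
proof -
  have "inj_on f (vecs F n)"
  proof (rule inj_onI)
    fix x y assume *: "x \<in> vecs F n" "y \<in> vecs F n" "f x = f y"
    then show "x = y"
      using assms by (intro vecs_eqI_dot[of x n y]) (metis isometry_dot)+
  qed
  moreover have "f ` vecs F n \<subseteq> vecs F n" using assms by (auto simp: isometry_closed)
  ultimately show ?thesis by (simp add: bij_betw_def endo_inj_surj finite_vecs)
qed

lemma isometry_inj: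
  "f \<in> isometries F n \<Longrightarrow> x \<in> vecs F n \<Longrightarrow> y \<in> vecs F n \<Longrightarrow> f x = f y \<Longrightarrow> x = y"
  using isometry_bij by (metis bij_betw_imp_inj_on inj_onD)

lemma isometry_compose:
  assumes "f \<in> isometries F n" "g \<in> isometries F n"
  shows "compose (vecs F n) f g \<in> isometries F n"
  unfolding isometries_def
  using assms by (auto simp: compose_eq isometry_closed isometry_dot)
    (auto simp: compose_def)

lemma isometry_inverse:
  assumes f: "f \<in> isometries F n"
  obtains g where "g \<in> isometries F n"
    "\<And>x. x \<in> vecs F n \<Longrightarrow> g (f x) = x" "\<And>x. x \<in> vecs F n \<Longrightarrow> f (g x) = x"
proof
  let ?g = "restrict (inv_into (vecs F n) f) (vecs F n)"
  have b: "bij_betw f (vecs F n) (vecs F n)" by (rule isometry_bij[OF f])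
  show gf: "?g (f x) = x" if "x \<in> vecs F n" for x
    using that b isometry_closed[OF f that] by (simp add: bij_betw_inv_into_left)
  show fg: "f (?g x) = x" if "x \<in> vecs F n" for x
    using that b by (simp add: bij_betw_inv_into_right)
  have closed: "?g x \<in> vecs F n" if "x \<in> vecs F n" for x
    using that b by (metis bij_betw_def inv_into_into restrict_apply')
  have "dot F n (?g x) (?g y) = dot F n x y" if "x \<in> vecs F n" "y \<in> vecs F n" for x y
    using isometry_dot[OF f closed[OF that(1)] closed[OF that(2)]] fg that by simp
  then show "?g \<in> isometries F n"
    unfolding isometries_def using closed by auto
qed

lemma finite_fixator: "finite (fixator F n S)"
  unfolding fixator_def using finite_isometries by simp

text \<open>If there are any such isometries at all, they form a coset of the fixator of \<open>insert y S\<close>: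
  undoing one of them maps the others into this fixator.\<close>

lemma card_fixator_fibre_le:
  assumes S: "S \<subseteq> vecs F n" and y: "y \<in> vecs F n"
  shows "card {f \<in> fixator F n S. f y = w} \<le> card (fixator F n (insert y S))"
proof (cases "{f \<in> fixator F n S. f y = w} = {}")
  case True
  show ?thesis unfolding True by simp
next
  case False
  then obtain f0 where f0: "f0 \<in> isometries F n" "\<And>x. x \<in> S \<Longrightarrow> f0 x = x" "f0 y = w"
    by (auto simp: fixator_def)
  obtain g where g: "g \<in> isometries F n"
    "\<And>x. x \<in> vecs F n \<Longrightarrow> g (f0 x) = x" "\<And>x. x \<in> vecs F n \<Longrightarrow> f0 (g x) = x"
    using isometry_inverse[OF f0(1)] by blast
  show ?thesis
  proof (rule card_inj_on_le)
    show "inj_on (compose (vecs F n) g) {f \<in> fixator F n S. f y = w}"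
    proof (rule inj_onI)
      fix f f' assume *: "f \<in> {f \<in> fixator F n S. f y = w}" "f' \<in> {f \<in> fixator F n S. f y = w}"
        "compose (vecs F n) g f = compose (vecs F n) g f'"
      then have ff: "f \<in> isometries F n" "f' \<in> isometries F n" by (auto simp: fixator_def)
      show "f = f'"
      proof (rule isometry_eqI[OF ff])
        fix x assume x: "x \<in> vecs F n"
        then have "g (f x) = g (f' x)" using fun_cong[OF *(3), of x] by (simp add: compose_eq)
        then show "f x = f' x" using g(3) ff x by (metis isometry_closed)
      qed
    qed
    show "compose (vecs F n) g ` {f \<in> fixator F n S. f y = w} \<subseteq> fixator F n (insert y S)"
    proof clarify
      fix f assume f: "f \<in> fixator F n S" "w = f y"
      then have "compose (vecs F n) g f \<in> isometries F n"
        using g(1) by (intro isometry_compose) (auto simp: fixator_def)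
      moreover have "g (f x) = x" if "x \<in> S" for x
        using that S f(1) f0(2) g(2)[of x] by (auto simp: fixator_def)
      moreover have "g (f y) = y" using f f0(3) g(2)[OF y] by simp
      ultimately show "compose (vecs F n) g f \<in> fixator F n (insert y S)"
        using S y by (auto simp: fixator_def compose_eq subset_iff)
    qed
  qed (rule finite_fixator)
qed

text \<open>The orbit-stabilizer bound, with the orbit replaced by any set \<open>Q\<close> that contains it.\<close>

lemma card_fixator_le:
  assumes S: "S \<subseteq> vecs F n" and y: "y \<in> vecs F n" and Q: "finite Q"
    and orbit: "\<And>f. f \<in> fixator F n S \<Longrightarrow> f y \<in> Q"
  shows "card (fixator F n S) \<le> card Q * card (fixator F n (insert y S))"
proof -
  have "fixator F n S = (\<Union>w\<in>Q. {f \<in> fixator F n S. f y = w})" using orbit by auto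
  then have "card (fixator F n S) = card (\<Union>w\<in>Q. {f \<in> fixator F n S. f y = w})" by (rule arg_cong)
  also have "\<dots> \<le> (\<Sum>w\<in>Q. card {f \<in> fixator F n S. f y = w})"
    by (rule card_UN_le[OF Q])
  also have "\<dots> \<le> (\<Sum>w\<in>Q. card (fixator F n (insert y S)))"
    by (intro sum_mono card_fixator_fibre_le S y)
  finally show ?thesis by simp
qed

section \<open>Few isometries take a prescribed value at a nonzero vector\<close>

text \<open>A coordinate at which \<open>m\<close> does not vanish can be recovered from the others and the product
  with \<open>m\<close>.  This is what lets the fixed vector \<open>m\<close> stand in for the basis vector number \<open>j0\<close>.\<close>

lemma vecs_eqI_dot_coordinates:
  assumes m: "m \<in> vecs F n" and j0: "j0 < n" "m j0 \<noteq> \<zero>"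
    and V: "x \<in> vecs F n" "y \<in> vecs F n"
    and eq: "\<And>i. i < n \<Longrightarrow> i \<noteq> j0 \<Longrightarrow> x i = y i"
    and dot: "dot F n x m = dot F n y m"
  shows "x = y"
proof -
  let ?d = "\<lambda>w. (\<Oplus>k\<in>{..<n} - {j0}. w k \<otimes> m k)"
  have split: "dot F n w m = w j0 \<otimes> m j0 \<oplus> ?d w" if "w \<in> vecs F n" for w
  proof -
    have "dot F n w m = (\<Oplus>k\<in>insert j0 ({..<n} - {j0}). w k \<otimes> m k)"
      using j0(1) by (simp add: dot_def insert_absorb)
    also have "\<dots> = w j0 \<otimes> m j0 \<oplus> ?d w"
      using that m j0(1) by (intro finsum_insert) (auto simp: vecs_nth)
    finally show ?thesis .
  qed
  have "?d x = ?d y" using eq V m by (intro finsum_cong') (auto simp: vecs_nth)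
  moreover have "?d y \<in> carrier F" using V m by (intro finsum_closed) (auto simp: vecs_nth)
  ultimately have "x j0 \<otimes> m j0 = y j0 \<otimes> m j0"
    using dot split[OF V(1)] split[OF V(2)] V m j0(1) by (auto simp: vecs_nth)
  then have "x j0 = y j0" using V m j0 by (metis m_rcancel vecs_nth)
  then show "x = y" using eq by (intro vecs_eqI[OF V]) metis
qed

lemma card_affine_le:
  assumes m: "m \<in> vecs F n" and j0: "j0 < n" "m j0 \<noteq> \<zero>"
    and J: "J \<subseteq> {..<n} - {j0}"
  shows "card {w \<in> vecs F n. (\<forall>j\<in>J. w j = \<zero>) \<and> dot F n w m = s} \<le> q ^ (n - 1 - card J)"
    (is "card ?W \<le> _")
proof -
  let ?I = "{..<n} - {j0} - J"
  have "inj_on (\<lambda>w. restrict w ?I) ?W"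
  proof (rule inj_onI)
    fix x y assume *: "x \<in> ?W" "y \<in> ?W" "restrict x ?I = restrict y ?I"
    then have V: "x \<in> vecs F n" "y \<in> vecs F n" by auto
    have eq: "x i = y i" if "i < n" "i \<noteq> j0" for i
    proof (cases "i \<in> J")
      case False
      then show ?thesis using that fun_cong[OF *(3), of i] by simp
    qed (use * in auto)
    show "x = y" by (rule vecs_eqI_dot_coordinates[OF m j0 V eq]) (use * in auto)
  qed
  moreover have "(\<lambda>w. restrict w ?I) ` ?W \<subseteq> ?I \<rightarrow>\<^sub>E carrier F"
    by (rule image_subsetI, rule restrict_PiE_iff[THEN iffD2]) (auto simp: vecs_nth)
  moreover have "finite (?I \<rightarrow>\<^sub>E carrier F)" by (intro finite_PiE) (auto simp: finite_carrier)
  ultimately have "card ?W \<le> card (?I \<rightarrow>\<^sub>E carrier F)" by (rule card_inj_on_le)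
  also have "\<dots> = q ^ card ?I" by (simp add: card_PiE)
  also have "card ?I = n - 1 - card J"
    using J j0(1) finite_subset[OF J] by (simp add: card_Diff_subset)
  finally show ?thesis .
qed

text \<open>An isometry that fixes \<open>m\<close> and the basis vectors in \<open>J\<close> sends the basis vector \<open>i\<close> into the
  set counted here: a quadric inside an affine space \<open>W\<close> of dimension \<open>n - 1 - |J|\<close>.  It suffices
  to find one direction \<open>u\<close>, parallel to \<open>W\<close>, such that no line in this direction lies on the quadric.
  If the direction space \<open>U\<close> of \<open>W\<close> contains an anisotropic vector, that vector works.  Otherwise
  \<open>U\<close> is orthogonal to itself by polarization, and the equation of the quadric is linear on \<open>W\<close>;
  it is not constant, because the vector \<open>u = m_j0 e_i - m_i e_j0\<close> of \<open>U\<close> has product \<open>m_j0 \<noteq> 0\<close>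
  with \<open>e_i\<close>, and hence with every point of \<open>W\<close>, as these differ from \<open>e_i\<close> by an element of \<open>U\<close>.\<close>

lemma card_quadric_section_le:
  assumes m: "m \<in> vecs F n" and j0: "j0 < n" "m j0 \<noteq> \<zero>"
    and J: "J \<subseteq> {..<n} - {j0}" and i: "i < n" "i \<noteq> j0" "i \<notin> J"
  shows "q * card {w \<in> vecs F n. (\<forall>j\<in>J. w j = \<zero>) \<and> dot F n w m = m i \<and> dot F n w w = \<one>}
      \<le> 2 * q ^ (n - 1 - card J)"
    (is "q * card ?Q \<le> _")
proof -
  define W where "W = {w \<in> vecs F n. (\<forall>j\<in>J. w j = \<zero>) \<and> dot F n w m = m i}"
  define U where "U = {u \<in> vecs F n. (\<forall>j\<in>J. u j = \<zero>) \<and> dot F n u m = \<zero>}"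
  have Jn: "j < n" "j \<noteq> j0" if "j \<in> J" for j using J that by auto
  have mi: "m i \<in> carrier F" "m j0 \<in> carrier F" using m i j0 by (auto simp: vecs_nth)
  have "\<exists>u\<in>U. \<forall>w\<in>W. dot F n u u \<noteq> \<zero> \<or> dot F n u w \<noteq> \<zero>"
  proof (cases "\<exists>u\<in>U. dot F n u u \<noteq> \<zero>")
    case False
    then have iso: "dot F n u u = \<zero>" if "u \<in> U" for u using that by blast
    have U_plus: "vec_plus F n u v \<in> U" if "u \<in> U" "v \<in> U" for u v
      using that m Jn by (auto simp: U_def vec_closed dot_bilinear vec_nth)
    have iso2: "dot F n u v = \<zero>" if "u \<in> U" "v \<in> U" for u v
    proof -
      have uv: "u \<in> vecs F n" "v \<in> vecs F n" using that by (auto simp: U_def)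
      have "dot F n u v \<oplus> dot F n u v = \<zero>"
        using iso[OF U_plus[OF that]] iso[OF that(1)] iso[OF that(2)] uv
        by (simp add: dot_bilinear vec_closed dot_comm[of v n u])
      from double_eq_zero[OF dot_closed[OF uv] this] show ?thesis .
    qed
    let ?e = "unit_vec F n i" and ?e_pivot = "unit_vec F n j0"
    define u where "u = vec_plus F n (smul F n (m j0) ?e) (smul F n (\<ominus> m i) ?e_pivot)"
    have em: "dot F n ?e m = m i" "dot F n ?e_pivot m = m j0"
      using m i j0 by (simp_all add: dot_comm[OF unit_vec_closed] dot_unit_vec)
    have uV: "u \<in> vecs F n" using mi by (simp add: u_def vec_closed)
    have "dot F n u m = m j0 \<otimes> m i \<oplus> \<ominus> m i \<otimes> m j0"
      using m mi em by (simp add: u_def vec_closed dot_bilinear)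
    also have "\<dots> = \<zero>" using mi by (simp add: m_comm[of "m j0"] l_minus r_neg)
    finally have "dot F n u m = \<zero>" .
    moreover have "u j = \<zero>" if "j \<in> J" for j
    proof -
      have "j \<noteq> i" "j \<noteq> j0" "j < n" using that i Jn by auto
      then show ?thesis using mi by (simp add: u_def vec_nth)
    qed
    ultimately have uU: "u \<in> U" using uV by (simp add: U_def)
    have "dot F n u w = m j0" if w: "w \<in> W" for w
    proof -
      have wV: "w \<in> vecs F n" using w by (simp add: W_def)
      define v where "v = vec_plus F n w (smul F n (\<ominus> \<one>) ?e)"
      have "v \<in> vecs F n" using wV by (simp add: v_def vec_closed)
      moreover have "dot F n v m = \<zero>"
        using w wV m mi em by (simp add: W_def v_def vec_closed dot_bilinear l_minus r_neg)
      moreover have "v j = \<zero>" if "j \<in> J" for j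
      proof -
        have "j \<noteq> i" "j < n" "w j = \<zero>" using that i Jn w by (auto simp: W_def)
        then show ?thesis by (simp add: v_def vec_nth)
      qed
      ultimately have "v \<in> U" by (simp add: U_def)
      then have "dot F n u v = \<zero>" using iso2 uU by blast
      then have "dot F n u w \<oplus> \<ominus> dot F n u ?e = \<zero>"
        unfolding v_def using wV uV by (simp add: dot_bilinear vec_closed l_minus)
      then have "dot F n u w = dot F n u ?e"
        using wV uV by (metis dot_closed minus_eq r_right_minus_eq unit_vec_closed)
      also have "\<dots> = m j0" using uV i mi by (simp add: dot_unit_vec u_def vec_nth)
      finally show ?thesis .
    qed
    then show ?thesis using uU j0(2) by metis
  qed blast
  then obtain u where u: "u \<in> U" "\<And>w. w \<in> W \<Longrightarrow> dot F n u u \<noteq> \<zero> \<or> dot F n u w \<noteq> \<zero>"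
    by blast
  have uV: "u \<in> vecs F n" using u by (simp add: U_def)
  have "q * card ?Q \<le> 2 * card W"
  proof (rule card_le_2_per_line[where u = u and n = n])
    show shift: "vec_plus F n w (smul F n t u) \<in> W" if "w \<in> W" "t \<in> carrier F" for w t
      using that u(1) m mi Jn by (auto simp: U_def W_def vec_closed dot_bilinear vec_nth)
    fix w assume w: "w \<in> W"
    have "card {t \<in> carrier F. vec_plus F n w (smul F n t u) \<in> ?Q} \<le>
      card {t \<in> carrier F.
        dot F n (vec_plus F n w (smul F n t u)) (vec_plus F n w (smul F n t u)) = \<one>}"
      by (intro card_mono) (auto simp: finite_carrier)
    also have "\<dots> \<le> 2"
      using w u(2)[OF w] uV by (intro card_quadric_line_le_2) (auto simp: W_def)
    finally show "card {t \<in> carrier F. vec_plus F n w (smul F n t u) \<in> ?Q} \<le> 2" .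
  qed (use uV in \<open>auto simp: W_def\<close>)
  also have "card W \<le> q ^ (n - 1 - card J)"
    unfolding W_def by (rule card_affine_le[OF m j0 J])
  finally show ?thesis by simp
qed

text \<open>Induction on the number \<open>l\<close> of basis vectors, apart from \<open>j0\<close>, that are still free: fixing one
  more of them costs a factor of at most \<open>2 q^(l - 1)\<close>.  When none is left, \<open>m\<close> and the fixed basis
  vectors determine an isometry.\<close>

lemma card_fixator_frame_le:
  assumes m: "m \<in> vecs F n" and j0: "j0 < n" "m j0 \<noteq> \<zero>"
    and J: "J \<subseteq> {..<n} - {j0}" and l: "l + card J = n - 1"
  shows "card (fixator F n (insert m (unit_vec F n ` J))) \<le> (\<Prod>k<l. 2 * q ^ k)"
  using J l
proof (induction l arbitrary: J)
  case 0
  then have "J = {..<n} - {j0}" using j0(1) by (intro card_subset_eq) auto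
  have "f = f'" if f: "f \<in> fixator F n (insert m (unit_vec F n ` J))"
      and f': "f' \<in> fixator F n (insert m (unit_vec F n ` J))" for f f'
  proof (rule isometry_eqI)
    show I: "f \<in> isometries F n" "f' \<in> isometries F n" using f f' by (auto simp: fixator_def)
    fix x assume x: "x \<in> vecs F n"
    have V: "f x \<in> vecs F n" "f' x \<in> vecs F n" using I x by (auto simp: isometry_closed)
    have dots: "dot F n (f x) y = dot F n (f' x) y" if "y \<in> insert m (unit_vec F n ` J)" for y
    proof -
      have "y \<in> vecs F n" "f y = y" "f' y = y"
        using that f f' m by (auto simp: fixator_def unit_vec_closed)
      then show ?thesis using isometry_dot[OF I(1) x] isometry_dot[OF I(2) x] by metis
    qed
    have coords: "f x j = f' x j" if "j < n" "j \<noteq> j0" for j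
      using dots[of "unit_vec F n j"] that V \<open>J = _\<close> by (simp add: dot_unit_vec)
    show "f x = f' x"
      by (rule vecs_eqI_dot_coordinates[OF m j0 V coords]) (simp_all add: dots)
  qed
  then have "card (fixator F n (insert m (unit_vec F n ` J))) \<le> Suc 0"
    unfolding card_le_Suc0_iff_eq[OF finite_fixator] by blast
  then show ?case by simp
next
  case (Suc l)
  have "finite J" using Suc.prems(1) finite_subset by blast
  have "card ({..<n} - {j0}) = n - 1" using j0(1) by simp
  then have "J \<noteq> {..<n} - {j0}" using Suc.prems(2) by auto
  then obtain i where i: "i < n" "i \<noteq> j0" "i \<notin> J" using Suc.prems(1) by auto
  let ?S = "insert m (unit_vec F n ` J)"
  let ?Q = "{w \<in> vecs F n. (\<forall>j\<in>J. w j = \<zero>) \<and> dot F n w m = m i \<and> dot F n w w = \<one>}"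
  have orbit: "f (unit_vec F n i) \<in> ?Q" if f: "f \<in> fixator F n ?S" for f
  proof -
    have I: "f \<in> isometries F n" using f by (simp add: fixator_def)
    let ?w = "f (unit_vec F n i)"
    have w: "?w \<in> vecs F n" using I by (simp add: isometry_closed unit_vec_closed)
    have *: "dot F n ?w y = y i" if "y \<in> vecs F n" "f y = y" for y
      using isometry_dot[OF I unit_vec_closed that(1), of i] that i
      by (simp add: dot_comm[of _ n y] unit_vec_closed dot_unit_vec)
    have "?w j = \<zero>" if "j \<in> J" for j
    proof -
      have "j < n" "i \<noteq> j" using that Suc.prems(1) i by auto
      moreover have "f (unit_vec F n j) = unit_vec F n j" using f that by (auto simp: fixator_def)
      ultimately show ?thesis
        using *[OF unit_vec_closed, of j] w i by (simp add: dot_unit_vec vec_nth)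
    qed
    moreover have "dot F n ?w m = m i" using * m f by (auto simp: fixator_def)
    moreover have "dot F n ?w ?w = \<one>"
      using isometry_dot[OF I unit_vec_closed unit_vec_closed] i
      by (simp add: dot_unit_vec unit_vec_closed vec_nth)
    ultimately show ?thesis using w by auto
  qed
  have "n - 1 - card J = Suc l" using Suc.prems(2) by simp
  then have "q * card ?Q \<le> q * (2 * q ^ l)"
    using card_quadric_section_le[OF m j0 Suc.prems(1) i] by (simp add: mult_ac)
  then have Q: "card ?Q \<le> 2 * q ^ l" using q_ge_3 by simp
  have "card (fixator F n ?S) \<le> card ?Q * card (fixator F n (insert (unit_vec F n i) ?S))"
    using orbit m finite_vecs by (intro card_fixator_le) (auto simp: unit_vec_closed)
  also have "insert (unit_vec F n i) ?S = insert m (unit_vec F n ` insert i J)" by auto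
  also have "card ?Q * card (fixator F n (insert m (unit_vec F n ` insert i J)))
      \<le> 2 * q ^ l * (\<Prod>k<l. 2 * q ^ k)"
    using Suc.prems i \<open>finite J\<close> by (intro mult_mono Q Suc.IH) auto
  finally show ?case by (simp add: mult_ac)
qed

lemma card_isometries_transport_le:
  assumes m: "m \<in> vecs F n" and nz: "\<exists>j<n. m j \<noteq> \<zero>"
  shows "card {f \<in> isometries F n. f m = w} \<le> (\<Prod>k<n - 1. 2 * q ^ k)"
proof -
  obtain j0 where j0: "j0 < n" "m j0 \<noteq> \<zero>" using nz by blast
  have "card {f \<in> fixator F n {}. f m = w} \<le> card (fixator F n {m})"
    using m by (intro card_fixator_fibre_le) auto
  also have "\<dots> \<le> (\<Prod>k<n - 1. 2 * q ^ k)"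
    using card_fixator_frame_le[OF m j0, of "{}"] by simp
  finally show ?thesis by (simp add: fixator_def)
qed

end

section \<open>Many isometries\<close>

definition zero_vec :: "('a, 'm) ring_scheme \<Rightarrow> nat \<Rightarrow> (nat \<Rightarrow> 'a)" where
  "zero_vec F n = (\<lambda>i\<in>{..<n}. \<zero>\<^bsub>F\<^esub>)"

definition reflection :: "('a, 'm) ring_scheme \<Rightarrow> nat \<Rightarrow> (nat \<Rightarrow> 'a) \<Rightarrow> (nat \<Rightarrow> 'a) \<Rightarrow> (nat \<Rightarrow> 'a)" where
  "reflection F n v = (\<lambda>x\<in>vecs F n. vec_plus F n x
     (smul F n (\<ominus>\<^bsub>F\<^esub> ((dot F n x v \<oplus>\<^bsub>F\<^esub> dot F n x v) \<otimes>\<^bsub>F\<^esub> inv\<^bsub>F\<^esub> (dot F n v v))) v))"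

definition extend_isometry :: "('a, 'm) ring_scheme \<Rightarrow> nat \<Rightarrow> ((nat \<Rightarrow> 'a) \<Rightarrow> (nat \<Rightarrow> 'a))
    \<Rightarrow> (nat \<Rightarrow> 'a) \<Rightarrow> (nat \<Rightarrow> 'a)" where
  "extend_isometry F n h = (\<lambda>x\<in>vecs F (Suc n). (h (restrict x {..<n}))(n := x n))"

definition matrix_of :: "('a, 'm) ring_scheme \<Rightarrow> nat \<Rightarrow> ((nat \<Rightarrow> 'a) \<Rightarrow> (nat \<Rightarrow> 'a))
    \<Rightarrow> (nat \<Rightarrow> nat \<Rightarrow> 'a)" where
  "matrix_of F n f = (\<lambda>i\<in>{..<n}. \<lambda>j\<in>{..<n}. f (unit_vec F n j) i)"

context odd_finite_field
begin

lemma zero_vec_closed: "zero_vec F n \<in> vecs F n"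
  by (auto simp: zero_vec_def vecs_def)

lemma dot_zero_left: "x \<in> vecs F n \<Longrightarrow> dot F n (zero_vec F n) x = \<zero>"
  unfolding dot_def by (intro add.finprod_one_eqI) (auto simp: zero_vec_def vecs_nth)

lemma nonzero_vec_nth:
  assumes "x \<in> vecs F n" "x \<noteq> zero_vec F n"
  shows "\<exists>j<n. x j \<noteq> \<zero>"
proof (rule ccontr)
  assume "\<not> ?thesis"
  then have "x = zero_vec F n"
    using assms zero_vec_closed by (intro vecs_eqI[of x n]) (auto simp: zero_vec_def)
  then show False using assms by simp
qed

text \<open>In the absence of linearity this uses that the image of the zero vector is orthogonal to
  the range of \<open>f\<close>, which is everything.\<close>

lemma isometry_zero:
  assumes f: "f \<in> isometries F n"
  shows "f (zero_vec F n) = zero_vec F n"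
proof -
  obtain g where g: "g \<in> isometries F n" "\<And>x. x \<in> vecs F n \<Longrightarrow> f (g x) = x"
    using isometry_inverse[OF f] by blast
  show ?thesis
  proof (rule vecs_eqI_dot)
    fix z assume z: "z \<in> vecs F n"
    then show "dot F n (f (zero_vec F n)) z = dot F n (zero_vec F n) z"
      using isometry_dot[OF f zero_vec_closed, of "g z"] isometry_closed[OF g(1) z] g(2)[OF z]
      by (simp add: dot_zero_left)
  qed (use f in \<open>auto simp: zero_vec_closed isometry_closed\<close>)
qed

lemma reflection_apply:
  "x \<in> vecs F n \<Longrightarrow> reflection F n v x = vec_plus F n x
     (smul F n (\<ominus> ((dot F n x v \<oplus> dot F n x v) \<otimes> inv (dot F n v v))) v)"
  by (simp add: reflection_def)

lemma reflection_isometry: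
  assumes v: "v \<in> vecs F n" "dot F n v v \<noteq> \<zero>"
  shows "reflection F n v \<in> isometries F n"
proof -
  let ?i = "inv (dot F n v v)"
  have i: "?i \<in> carrier F" "dot F n v v \<otimes> ?i = \<one>"
    using v by (auto simp: field_Units)
  let ?c = "\<lambda>x. \<ominus> ((dot F n x v \<oplus> dot F n x v) \<otimes> ?i)"
  have c: "?c x \<in> carrier F" if "x \<in> vecs F n" for x using that v i by simp
  have closed: "reflection F n v x \<in> vecs F n" if "x \<in> vecs F n" for x
    using that v i by (simp add: reflection_apply vec_closed)
  have alg: "p \<oplus> b \<otimes> s \<oplus> a \<otimes> (t \<oplus> b \<otimes> N) = p"
    if "p \<in> carrier F" "s \<in> carrier F" "t \<in> carrier F" "N \<in> carrier F" "j \<in> carrier F"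
      "N \<otimes> j = \<one>"
      and a: "a = \<ominus> ((s \<oplus> s) \<otimes> j)" and b: "b = \<ominus> ((t \<oplus> t) \<otimes> j)"
    for p s t N j a b
  proof -
    have ab: "a \<in> carrier F" "b \<in> carrier F" using a b that by auto
    \<comment> \<open>The two correction terms a t and b s agree, and a b N cancels their sum.\<close>
    have "b \<otimes> N = \<ominus> ((t \<oplus> t) \<otimes> (N \<otimes> j))"
      unfolding b using that(1-5) by algebra
    then have bN: "b \<otimes> N = \<ominus> (t \<oplus> t)" using that by simp
    have bs: "b \<otimes> s = a \<otimes> t" unfolding a b using that(1-5) by algebra
    show ?thesis unfolding bN bs using that(1-5) ab by algebra
  qed
  have "dot F n (reflection F n v x) (reflection F n v y) = dot F n x y"
    if x: "x \<in> vecs F n" and y: "y \<in> vecs F n" for x y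
  proof -
    have "dot F n (reflection F n v x) (reflection F n v y) =
        dot F n x y \<oplus> ?c y \<otimes> dot F n x v \<oplus> ?c x \<otimes> (dot F n y v \<oplus> ?c y \<otimes> dot F n v v)"
    proof -
      have *: "(p \<oplus> a \<otimes> t) \<oplus> b \<otimes> (s \<oplus> a \<otimes> N) = p \<oplus> b \<otimes> s \<oplus> a \<otimes> (t \<oplus> b \<otimes> N)"
        if "p \<in> carrier F" "s \<in> carrier F" "t \<in> carrier F" "N \<in> carrier F"
          "a \<in> carrier F" "b \<in> carrier F" for p s t N a b
        using that by algebra
      show ?thesis
        unfolding reflection_apply[OF x] reflection_apply[OF y]
        using x y v(1) c[OF x] c[OF y]
          *[of "dot F n x y" "dot F n x v" "dot F n y v" "dot F n v v" "?c x" "?c y"]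
        by (simp add: dot_bilinear vec_closed dot_comm[of v n y])
    qed
    also have "\<dots> = dot F n x y"
      using x y v i by (intro alg[where j = ?i]) auto
    finally show ?thesis .
  qed
  then show ?thesis unfolding isometries_def using closed by (auto simp: reflection_def)
qed

lemma restrict_vecs: "x \<in> vecs F (Suc n) \<Longrightarrow> restrict x {..<n} \<in> vecs F n"
  using PiE_mem[of x "{..<Suc n}" "\<lambda>_. carrier F"] by (simp add: vecs_def)

lemma fun_upd_vecs: "x \<in> vecs F n \<Longrightarrow> t \<in> carrier F \<Longrightarrow> x(n := t) \<in> vecs F (Suc n)"
  unfolding vecs_def lessThan_Suc by (rule PiE_fun_upd) auto

lemma dot_fun_upd:
  assumes "x \<in> vecs F n" "s \<in> carrier F" "y \<in> vecs F n" "t \<in> carrier F"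
  shows "dot F (Suc n) (x(n := s)) (y(n := t)) = dot F n x y \<oplus> s \<otimes> t"
proof -
  have "dot F n (x(n := s)) (y(n := t)) = dot F n x y"
    using assms by (intro dot_cong) auto
  then show ?thesis using dot_Suc[OF fun_upd_vecs[OF assms(1,2)] fun_upd_vecs[OF assms(3,4)]] by simp
qed

lemma restrict_fun_upd_vecs: "x \<in> vecs F (Suc n) \<Longrightarrow> (restrict x {..<n})(n := x n) = x"
  by (intro vecs_eqI[of _ "Suc n"] fun_upd_vecs restrict_vecs) (auto simp: vecs_nth)

lemma extend_isometry:
  assumes h: "h \<in> isometries F n"
  shows "extend_isometry F n h \<in> isometries F (Suc n)"
proof -
  have closed: "extend_isometry F n h x \<in> vecs F (Suc n)" if "x \<in> vecs F (Suc n)" for x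
    using that h by (simp add: extend_isometry_def fun_upd_vecs isometry_closed restrict_vecs vecs_nth)
  have "dot F (Suc n) (extend_isometry F n h x) (extend_isometry F n h y) = dot F (Suc n) x y"
    if x: "x \<in> vecs F (Suc n)" and y: "y \<in> vecs F (Suc n)" for x y
  proof -
    let ?x = "restrict x {..<n}" and ?y = "restrict y {..<n}"
    have V: "?x \<in> vecs F n" "?y \<in> vecs F n" "x n \<in> carrier F" "y n \<in> carrier F"
      using x y by (auto simp: restrict_vecs vecs_nth)
    have "dot F (Suc n) (extend_isometry F n h x) (extend_isometry F n h y)
        = dot F n ?x ?y \<oplus> x n \<otimes> y n"
      using x y V h by (simp add: extend_isometry_def dot_fun_upd isometry_closed isometry_dot)
    also have "\<dots> = dot F (Suc n) (?x(n := x n)) (?y(n := y n))"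
      by (rule dot_fun_upd[OF V(1,3) V(2,4), symmetric])
    also have "\<dots> = dot F (Suc n) x y" by (simp only: restrict_fun_upd_vecs[OF x] restrict_fun_upd_vecs[OF y])
    finally show ?thesis .
  qed
  then show ?thesis
    unfolding isometries_def using closed by (auto simp: extend_isometry_def)
qed

lemma extend_isometry_last:
  assumes h: "h \<in> isometries F n"
  shows "extend_isometry F n h (unit_vec F (Suc n) n) = unit_vec F (Suc n) n"
proof -
  have "restrict (unit_vec F (Suc n) n) {..<n} = zero_vec F n"
    by (auto simp: zero_vec_def unit_vec_def restrict_def)
  then show ?thesis
    using isometry_zero[OF h] restrict_fun_upd_vecs[OF unit_vec_closed[of "Suc n" n]]
    by (simp add: extend_isometry_def unit_vec_closed)
qed

lemma extend_isometry_inj: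
  assumes h: "h \<in> isometries F n" "h' \<in> isometries F n"
    and eq: "extend_isometry F n h = extend_isometry F n h'"
  shows "h = h'"
proof (rule isometry_eqI[OF h])
  fix x assume x: "x \<in> vecs F n"
  have r: "restrict (x(n := \<zero>)) {..<n} = x"
    using x by (intro vecs_eqI[of _ n] restrict_vecs fun_upd_vecs) auto
  have upd: "(h x)(n := \<zero>) = (h' x)(n := \<zero>)"
    using fun_cong[OF eq, of "x(n := \<zero>)"] x r
    by (simp add: extend_isometry_def fun_upd_vecs)
  have "h x i = h' x i" if "i < n" for i
    using fun_cong[OF upd, of i] that by simp
  then show "h x = h' x"
    using x h by (intro vecs_eqI[of "h x" n]) (auto simp: isometry_closed)
qed

text \<open>Stereographic projection: the reflection in \<open>(k, 1)\<close> sends the last basis vector \<open>e\<close> to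
  \<open>e + c (k, 1)\<close> with \<open>c = - 2 / (k \<bullet> k + 1)\<close>.  The last coordinate gives back \<open>c\<close>, which is not zero,
  and then the others give back \<open>k\<close>.\<close>

lemma reflection_last_inj:
  assumes k: "k \<in> vecs F n" "dot F n k k \<oplus> \<one> \<noteq> \<zero>"
    and k': "k' \<in> vecs F n" "dot F n k' k' \<oplus> \<one> \<noteq> \<zero>"
    and eq: "reflection F (Suc n) (k(n := \<one>)) (unit_vec F (Suc n) n)
      = reflection F (Suc n) (k'(n := \<one>)) (unit_vec F (Suc n) n)"
  shows "k = k'"
proof -
  let ?e = "unit_vec F (Suc n) n"
  let ?c = "\<lambda>k. \<ominus> ((\<one> \<oplus> \<one>) \<otimes> inv (dot F n k k \<oplus> \<one>))"
  have refl: "reflection F (Suc n) (k(n := \<one>)) ?e = vec_plus F (Suc n) ?e (smul F (Suc n) (?c k) (k(n := \<one>)))"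
    if "k \<in> vecs F n" for k
    using that dot_comm[OF unit_vec_closed fun_upd_vecs[OF that one_closed], of n]
      dot_unit_vec[OF fun_upd_vecs[OF that one_closed], of n]
    by (simp add: reflection_apply unit_vec_closed dot_fun_upd)
  have c: "?c k \<in> carrier F" "?c k \<noteq> \<zero>"
    if "k \<in> vecs F n" "dot F n k k \<oplus> \<one> \<noteq> \<zero>" for k
  proof -
    have u: "dot F n k k \<oplus> \<one> \<in> Units F" using that by (simp add: field_Units)
    then have i: "inv (dot F n k k \<oplus> \<one>) \<in> carrier F" "inv (dot F n k k \<oplus> \<one>) \<noteq> \<zero>"
      using Units_inv_Units[OF u] by (auto simp: field_Units)
    then show "?c k \<in> carrier F" by simp
    have "(\<one> \<oplus> \<one>) \<otimes> inv (dot F n k k \<oplus> \<one>) \<noteq> \<zero>"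
      using i two_neq_zero integral by (metis a_closed one_closed)
    then show "?c k \<noteq> \<zero>" using i by (metis a_closed m_closed minus_minus minus_zero one_closed)
  qed
  have nth: "?e i \<oplus> ?c k \<otimes> (k(n := \<one>)) i = ?e i \<oplus> ?c k' \<otimes> (k'(n := \<one>)) i" if "i < Suc n" for i
    using fun_cong[OF eq, of i] that
    unfolding refl[OF k(1)] refl[OF k'(1)] by (simp add: vec_plus_nth smul_nth)
  have cc: "?c k = ?c k'"
    using nth[of n] c[OF k] c[OF k'] by (simp add: unit_vec_nth)
  show ?thesis
  proof (rule vecs_eqI[OF k(1) k'(1)])
    fix i assume i: "i < n"
    have "?c k \<otimes> k i = ?c k' \<otimes> k' i"
      using nth[of i] i k k' c[OF k] c[OF k'] by (simp add: unit_vec_nth vecs_nth)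
    then show "k i = k' i" using cc c[OF k] k k' i
      by (metis m_lcancel vecs_nth)
  qed
qed

text \<open>The vectors \<open>k\<close> with \<open>k \<bullet> k = - 1\<close> form a quadric without lines in the direction of a basis
  vector, so at most a proportion \<open>2 / q\<close> of all vectors is excluded; since \<open>q \<ge> 3\<close>, a third
  remains.  In dimension 0 there is no such direction, and nothing is excluded.\<close>

lemma card_anisotropic_ge: "q ^ n \<le> 3 * card {k \<in> vecs F n. dot F n k k \<oplus> \<one> \<noteq> \<zero>}"
proof (cases n)
  case 0
  have "dot F 0 k k = \<zero>" for k by (simp add: dot_def)
  then have "{k \<in> vecs F n. dot F n k k \<oplus> \<one> \<noteq> \<zero>} = vecs F n" using 0 by auto
  then show ?thesis by (simp only: card_vecs)
next
  case (Suc n')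
  let ?u = "unit_vec F n 0"
  let ?Z = "{k \<in> vecs F n. dot F n k k = \<ominus> \<one>}"
  have uu: "dot F n ?u ?u \<noteq> \<zero>"
    using Suc by (simp add: dot_unit_vec unit_vec_closed unit_vec_nth)
  have "q * card ?Z \<le> 2 * card (vecs F n)"
  proof (rule card_le_2_per_line[where u = ?u and n = n])
    fix w assume w: "w \<in> vecs F n"
    have "card {t \<in> carrier F. vec_plus F n w (smul F n t ?u) \<in> ?Z} \<le>
      card {t \<in> carrier F.
        dot F n (vec_plus F n w (smul F n t ?u)) (vec_plus F n w (smul F n t ?u)) = \<ominus> \<one>}"
      by (intro card_mono) (auto simp: finite_carrier)
    also have "\<dots> \<le> 2"
      using w uu by (intro card_quadric_line_le_2) (auto simp: unit_vec_closed)
    finally show "card {t \<in> carrier F. vec_plus F n w (smul F n t ?u) \<in> ?Z} \<le> 2" .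
  qed (auto simp: vec_closed)
  then have Z: "q * card ?Z \<le> 2 * q ^ n" by (simp add: card_vecs)
  have "x \<oplus> \<one> \<noteq> \<zero> \<longleftrightarrow> x \<noteq> \<ominus> \<one>" if "x \<in> carrier F" for x
    using that by (metis l_neg minus_equality minus_minus one_closed a_comm)
  then have "{k \<in> vecs F n. dot F n k k \<oplus> \<one> \<noteq> \<zero>} = vecs F n - ?Z" by auto
  then have K: "card {k \<in> vecs F n. dot F n k k \<oplus> \<one> \<noteq> \<zero>} = q ^ n - card ?Z"
    using finite_vecs by (simp add: card_Diff_subset card_vecs)
  have "q * (3 * card ?Z) \<le> 6 * q ^ n" using Z by simp
  also have "q * q ^ n + \<dots> \<le> 3 * (q * q ^ n)"
  proof -
    have "3 * q ^ n \<le> q * q ^ n" using q_ge_3 by (rule mult_le_mono1)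
    then show ?thesis by simp
  qed
  finally have "q * (q ^ n + 3 * card ?Z) \<le> q * (3 * q ^ n)" by (simp add: algebra_simps)
  then have "q ^ n + 3 * card ?Z \<le> 3 * q ^ n" using q_ge_3 by simp
  then show ?thesis unfolding K by linarith
qed

text \<open>The compositions of the reflection in \<open>(k, 1)\<close> with the extension of \<open>h\<close> are pairwise
  distinct: the extension fixes the last basis vector, so the image of this vector determines \<open>k\<close>,
  and cancelling the reflection determines \<open>h\<close>.\<close>

lemma card_isometries_Suc_ge:
  "q ^ n * card (isometries F n) \<le> 3 * card (isometries F (Suc n))"
proof -
  let ?K = "{k \<in> vecs F n. dot F n k k \<oplus> \<one> \<noteq> \<zero>}"
  let ?V = "vecs F (Suc n)" and ?e = "unit_vec F (Suc n) n"
  let ?\<rho> = "\<lambda>k. reflection F (Suc n) (k(n := \<one>))"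
  let ?\<Phi> = "\<lambda>(k, h). compose ?V (?\<rho> k) (extend_isometry F n h)"
  have \<rho>: "?\<rho> k \<in> isometries F (Suc n)" if "k \<in> ?K" for k
    using that by (intro reflection_isometry) (auto simp: fun_upd_vecs dot_fun_upd)
  have "inj_on ?\<Phi> (?K \<times> isometries F n)"
  proof (rule inj_onI, clarify)
    fix k h k' h'
    assume k: "k \<in> vecs F n" "dot F n k k \<oplus> \<one> \<noteq> \<zero>" and k': "k' \<in> vecs F n" "dot F n k' k' \<oplus> \<one> \<noteq> \<zero>"
      and h: "h \<in> isometries F n" and h': "h' \<in> isometries F n"
      and eq: "compose ?V (?\<rho> k) (extend_isometry F n h) = compose ?V (?\<rho> k') (extend_isometry F n h')"
    have app: "?\<rho> k (extend_isometry F n h x) = ?\<rho> k' (extend_isometry F n h' x)" if "x \<in> ?V" for x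
      using fun_cong[OF eq, of x] that by (simp add: compose_eq)
    have "k = k'"
      using app[OF unit_vec_closed, of n] h h'
      by (intro reflection_last_inj[OF k k']) (simp add: extend_isometry_last)
    moreover have "extend_isometry F n h = extend_isometry F n h'"
    proof (rule isometry_eqI[OF extend_isometry[OF h] extend_isometry[OF h']])
      fix x assume "x \<in> ?V"
      then show "extend_isometry F n h x = extend_isometry F n h' x"
        using app[of x] \<open>k = k'\<close> \<rho>[of k] k h h'
        by (auto intro: isometry_inj[of "?\<rho> k" "Suc n"] simp: isometry_closed extend_isometry)
    qed
    ultimately show "k = k' \<and> h = h'" using extend_isometry_inj[OF h h'] by blast
  qed
  moreover have "?\<Phi> ` (?K \<times> isometries F n) \<subseteq> isometries F (Suc n)"
    using \<rho> by (auto intro!: isometry_compose extend_isometry)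
  ultimately have "card (?K \<times> isometries F n) \<le> card (isometries F (Suc n))"
    by (rule card_inj_on_le) (rule finite_isometries)
  then have "card ?K * card (isometries F n) \<le> card (isometries F (Suc n))"
    by (simp add: card_cartesian_product)
  moreover have "q ^ n * card (isometries F n) \<le> 3 * card ?K * card (isometries F n)"
    by (rule mult_le_mono1[OF card_anisotropic_ge])
  ultimately show ?thesis by linarith
qed

lemma card_isometries_ge: "(\<Prod>k<n. q ^ k) \<le> 3 ^ n * card (isometries F n)"
proof (induction n)
  case 0
  have "restrict id (vecs F 0) \<in> isometries F 0" by (auto simp: isometries_def)
  then have "card (isometries F 0) \<noteq> 0" using finite_isometries by auto
  then show ?case by simp
next
  case (Suc n)
  have "(\<Prod>k<Suc n. q ^ k) = (\<Prod>k<n. q ^ k) * q ^ n" by simp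
  also have "\<dots> \<le> (3 ^ n * card (isometries F n)) * q ^ n" by (rule mult_le_mono1[OF Suc.IH])
  also have "\<dots> = 3 ^ n * (q ^ n * card (isometries F n))" by simp
  also have "\<dots> \<le> 3 ^ n * (3 * card (isometries F (Suc n)))"
    by (rule mult_le_mono2[OF card_isometries_Suc_ge])
  finally show ?case by simp
qed

section \<open>Orthogonal matrices as isometries\<close>

lemma finite_orth: "finite (orth F n)"
proof -
  have "finite (mats F n)"
    unfolding mats_def by (intro finite_PiE) (auto simp: finite_carrier)
  then show ?thesis by (simp add: orth_def)
qed

lemma matrix_of_orth:
  assumes f: "f \<in> isometries F n"
  shows "matrix_of F n f \<in> orth F n"
proof -
  have V: "f (unit_vec F n j) \<in> vecs F n" for j
    using f by (simp add: isometry_closed unit_vec_closed)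
  have "matrix_of F n f \<in> mats F n"
    by (auto simp: matrix_of_def mats_def vecs_nth[OF V] split: if_splits)
  moreover have "(\<Oplus>k\<in>{..<n}. mat_transpose n (matrix_of F n f) i k \<otimes> matrix_of F n f k j)
      = (if i = j then \<one> else \<zero>)" if ij: "i < n" "j < n" for i j
  proof -
    have "(\<Oplus>k\<in>{..<n}. mat_transpose n (matrix_of F n f) i k \<otimes> matrix_of F n f k j)
        = dot F n (f (unit_vec F n i)) (f (unit_vec F n j))"
      unfolding dot_def using ij
      by (intro finsum_cong') (auto simp: mat_transpose_def matrix_of_def vecs_nth[OF V])
    also have "\<dots> = (if i = j then \<one> else \<zero>)"
      using ij f isometry_dot[OF f unit_vec_closed unit_vec_closed]
      by (auto simp: unit_vec_closed dot_unit_vec unit_vec_nth)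
    finally show ?thesis .
  qed
  ultimately show ?thesis
    by (simp add: orth_def mat_mult_def mat_id_def cong: restrict_cong)
qed

text \<open>The values \<open>c_j\<close> at the basis vectors determine \<open>f\<close>, because \<open>f x \<bullet> c_j = x_j\<close> and, after
  undoing \<open>f\<close>, the products with the \<open>c_j\<close> are coordinates.\<close>

lemma matrix_of_inj: "inj_on (matrix_of F n) (isometries F n)"
proof (rule inj_onI)
  fix f f' assume f: "f \<in> isometries F n" "f' \<in> isometries F n"
    and eq: "matrix_of F n f = matrix_of F n f'"
  have e: "f (unit_vec F n j) = f' (unit_vec F n j)" if j: "j < n" for j
  proof (rule vecs_eqI)
    fix i assume "i < n"
    then show "f (unit_vec F n j) i = f' (unit_vec F n j) i"
      using fun_cong[OF fun_cong[OF eq, of i], of j] j by (simp add: matrix_of_def)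
  qed (use f in \<open>simp_all add: isometry_closed unit_vec_closed\<close>)
  obtain g where g: "g \<in> isometries F n" "\<And>x. x \<in> vecs F n \<Longrightarrow> f (g x) = x"
    using isometry_inverse[OF f(1)] by blast
  show "f = f'"
  proof (rule isometry_eqI[OF f])
    fix x assume x: "x \<in> vecs F n"
    have V: "f x \<in> vecs F n" "f' x \<in> vecs F n" using f x by (auto simp: isometry_closed)
    have gnth: "g y j = dot F n y (f (unit_vec F n j))" if "y \<in> vecs F n" "j < n" for y j
      using isometry_dot[OF f(1) isometry_closed[OF g(1) that(1)] unit_vec_closed, of j] that
      by (simp add: g isometry_closed dot_unit_vec)
    have "g (f x) = g (f' x)"
    proof (rule vecs_eqI)
      fix j assume j: "j < n"
      have "g (f x) j = dot F n x (unit_vec F n j)"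
        using j V x f by (simp add: gnth isometry_dot unit_vec_closed)
      also have "\<dots> = dot F n (f' x) (f' (unit_vec F n j))"
        using x f by (simp add: isometry_dot unit_vec_closed)
      also have "\<dots> = g (f' x) j" using j V by (simp add: gnth e)
      finally show "g (f x) j = g (f' x) j" .
    qed (use g V in \<open>simp_all add: isometry_closed\<close>)
    then show "f x = f' x" using isometry_inj[OF g(1) V] by simp
  qed
qed

lemma card_isometries_le_orth: "card (isometries F n) \<le> card (orth F n)"
  by (rule card_inj_on_le[OF matrix_of_inj _ finite_orth]) (auto intro: matrix_of_orth)

lemma mats_nth: "g \<in> mats F n \<Longrightarrow> i < n \<Longrightarrow> j < n \<Longrightarrow> g i j \<in> carrier F"
  using PiE_mem[of g "{..<n}" "\<lambda>_. {..<n} \<rightarrow>\<^sub>E carrier F" i]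
    PiE_mem[of "g i" "{..<n}" "\<lambda>_. carrier F" j]
  by (simp add: mats_def)

lemma mat_vec_closed:
  assumes "g \<in> mats F n" "x \<in> vecs F n"
  shows "mat_vec F n g x \<in> vecs F n"
proof -
  have "(\<Oplus>k\<in>{..<n}. g i k \<otimes> x k) \<in> carrier F" if "i < n" for i
    using assms that by (intro finsum_closed) (auto simp: mats_nth vecs_nth)
  then show ?thesis by (simp add: mat_vec_def vecs_def)
qed

text \<open>Moving a matrix to the other side of the dot product, with the transpose written out through
  the columns of \<open>g\<close>.\<close>

lemma dot_mat_vec:
  assumes g: "g \<in> mats F n" and x: "x \<in> vecs F n" and y: "y \<in> vecs F n"
  shows "dot F n (mat_vec F n g x) y
    = (\<Oplus>k\<in>{..<n}. x k \<otimes> dot F n (\<lambda>i\<in>{..<n}. g i k) y)"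
proof -
  have "dot F n (mat_vec F n g x) y = (\<Oplus>i\<in>{..<n}. \<Oplus>k\<in>{..<n}. g i k \<otimes> x k \<otimes> y i)"
    unfolding dot_def using g x y
    by (intro finsum_cong') (auto simp: mat_vec_def mats_nth vecs_nth finsum_ldistr intro!: finsum_closed)
  also have "\<dots> = (\<Oplus>k\<in>{..<n}. \<Oplus>i\<in>{..<n}. g i k \<otimes> x k \<otimes> y i)"
    using g x y by (intro finsum_swap) (auto simp: mats_nth vecs_nth)
  also have "\<dots> = (\<Oplus>k\<in>{..<n}. x k \<otimes> (\<Oplus>i\<in>{..<n}. g i k \<otimes> y i))"
    using g x y
    by (intro finsum_cong') (auto simp: mats_nth vecs_nth finsum_rdistr m_ac intro!: finsum_closed finsum_cong')
  also have "\<dots> = (\<Oplus>k\<in>{..<n}. x k \<otimes> dot F n (\<lambda>i\<in>{..<n}. g i k) y)"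
  proof -
    have "dot F n (\<lambda>i\<in>{..<n}. g i k) y = (\<Oplus>i\<in>{..<n}. g i k \<otimes> y i)" if "k < n" for k
      unfolding dot_def using that g y by (intro finsum_cong') (auto simp: mats_nth vecs_nth)
    then show ?thesis
      using g x y by (intro finsum_cong') (auto simp: mats_nth vecs_nth intro!: finsum_closed)
  qed
  finally show ?thesis .
qed

lemma orth_columns:
  assumes g: "g \<in> orth F n" and "i < n" "j < n"
  shows "dot F n (\<lambda>k\<in>{..<n}. g k i) (\<lambda>k\<in>{..<n}. g k j) = (if i = j then \<one> else \<zero>)"
proof -
  have m: "g \<in> mats F n" using g by (simp add: orth_def)
  have "dot F n (\<lambda>k\<in>{..<n}. g k i) (\<lambda>k\<in>{..<n}. g k j) = mat_mult F n (mat_transpose n g) g i j"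
    unfolding dot_def mat_mult_def using assms m
    by (auto simp: mat_transpose_def mats_nth intro!: finsum_cong')
  also have "\<dots> = mat_id F n i j" using g by (simp add: orth_def)
  finally show ?thesis using assms by (simp add: mat_id_def)
qed

lemma orth_isometry:
  assumes g: "g \<in> orth F n"
  shows "restrict (mat_vec F n g) (vecs F n) \<in> isometries F n"
proof -
  have m: "g \<in> mats F n" using g by (simp add: orth_def)
  let ?col = "\<lambda>j. \<lambda>k\<in>{..<n}. g k j"
  have col: "?col j \<in> vecs F n" if "j < n" for j using m that by (auto simp: vecs_def mats_nth)
  have "dot F n (mat_vec F n g x) (mat_vec F n g y) = dot F n x y"
    if x: "x \<in> vecs F n" and y: "y \<in> vecs F n" for x y
  proof -
    have "dot F n (?col k) (mat_vec F n g y) = y k" if k: "k < n" for k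
    proof -
      have "dot F n (?col k) (mat_vec F n g y) = (\<Oplus>j\<in>{..<n}. y j \<otimes> dot F n (?col j) (?col k))"
        using dot_mat_vec[OF m y col[OF k]] dot_comm[OF col[OF k] mat_vec_closed[OF m y]] by simp
      also have "\<dots> = (\<Oplus>j\<in>{..<n}. if k = j then y j else \<zero>)"
        using k y by (intro finsum_cong') (auto simp: orth_columns[OF g] vecs_nth)
      also have "\<dots> = y k" using k y by (intro finsum_singleton) (auto simp: vecs_nth)
      finally show ?thesis .
    qed
    then have "(\<Oplus>k\<in>{..<n}. x k \<otimes> dot F n (?col k) (mat_vec F n g y)) = dot F n x y"
      unfolding dot_def[of F n x y] using x y by (intro finsum_cong') (auto simp: vecs_nth)
    then show ?thesis using dot_mat_vec[OF m x mat_vec_closed[OF m y]] by simp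
  qed
  then show ?thesis unfolding isometries_def using m by (auto simp: mat_vec_closed)
qed

lemma mat_vec_unit_vec:
  assumes "g \<in> mats F n" "i < n" "j < n"
  shows "mat_vec F n g (unit_vec F n j) i = g i j"
proof -
  have "mat_vec F n g (unit_vec F n j) i = (\<Oplus>k\<in>{..<n}. if j = k then g i k else \<zero>)"
    unfolding mat_vec_def using assms
    by (auto simp: unit_vec_nth mats_nth intro!: finsum_cong')
  also have "\<dots> = g i j" using assms by (intro finsum_singleton) (auto simp: mats_nth)
  finally show ?thesis .
qed

lemma orth_isometry_inj: "inj_on (\<lambda>g. restrict (mat_vec F n g) (vecs F n)) (orth F n)"
proof (rule inj_onI)
  fix g h assume g: "g \<in> orth F n" and h: "h \<in> orth F n"
    and eq: "restrict (mat_vec F n g) (vecs F n) = restrict (mat_vec F n h) (vecs F n)"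
  have m: "g \<in> mats F n" "h \<in> mats F n" using g h by (auto simp: orth_def)
  have nth: "g i j = h i j" if "i < n" "j < n" for i j
    using fun_cong[OF eq, of "unit_vec F n j"] that m
    by (metis mat_vec_unit_vec restrict_apply' unit_vec_closed)
  have "g i = h i" if "i < n" for i
  proof (rule vecs_eqI)
    show "g i \<in> vecs F n" "h i \<in> vecs F n"
      using m that by (auto simp: mats_def vecs_def)
  qed (use nth that in auto)
  then show "g = h"
    using m unfolding mats_def
    by (intro PiE_ext[of g "{..<n}" "\<lambda>_. {..<n} \<rightarrow>\<^sub>E carrier F" h]) auto
qed

end

section \<open>A nontrivial additive character\<close>

text \<open>Take a proper subgroup \<open>H\<close> of maximal order and \<open>x\<close> outside \<open>H\<close>.  By maximality \<open>H\<close> and \<open>x\<close>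
  generate the group, so every element is \<open>h \<otimes> x [^] k\<close> with \<open>h \<in> H\<close>.  If \<open>n\<close> is the order of \<open>x\<close>
  modulo \<open>H\<close>, then \<open>k\<close> is unique modulo \<open>n\<close>, and \<open>exp (2 \<pi> i k / n)\<close> is a well-defined character,
  trivial on \<open>H\<close>.  It is not trivial at \<open>x\<close>, because \<open>x \<notin> H\<close> forces \<open>n \<ge> 2\<close>.\<close>

lemma (in comm_group) exists_nontrivial_character:
  assumes fin: "finite (carrier G)" and nontriv: "carrier G \<noteq> {\<one>}"
  shows "\<exists>\<chi>::'a \<Rightarrow> complex. (\<forall>x\<in>carrier G. \<forall>y\<in>carrier G. \<chi> (x \<otimes> y) = \<chi> x * \<chi> y) \<and>
    (\<forall>x\<in>carrier G. cmod (\<chi> x) = 1) \<and> (\<exists>x\<in>carrier G. \<chi> x \<noteq> 1)"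
proof -
  let ?S = "{H. subgroup H G \<and> H \<noteq> carrier G}"
  have "finite ?S"
    by (rule finite_subset[of _ "Pow (carrier G)"]) (auto simp: fin dest: subgroup.subset)
  moreover have "{\<one>} \<in> ?S" using nontriv triv_subgroup by auto
  ultimately have "Max (card ` ?S) \<in> card ` ?S" by (intro Max_in) auto
  then obtain H where card_H: "Max (card ` ?S) = card H" and H: "H \<in> ?S" by (rule imageE)
  have max: "card K \<le> card H" if "K \<in> ?S" for K
    unfolding card_H[symmetric] using that \<open>finite ?S\<close> by (intro Max_ge) auto
  have sub: "subgroup H G" using H by simp
  note sub_closed = subgroup.m_closed[OF sub] subgroup.m_inv_closed[OF sub] subgroup.one_closed[OF sub]
    subgroup.mem_carrier[OF sub]
  obtain x where x: "x \<in> carrier G" "x \<notin> H" using H sub_closed by blast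
  \<comment> \<open>The subgroup generated by H and x; its exponents are integers, so that inverses are easy.\<close>
  define K where "K = {h \<otimes> x [^] k |h (k::int). h \<in> H}"
  have "subgroup K G"
  proof (rule subgroupI)
    show "K \<subseteq> carrier G" using x sub_closed by (auto simp: K_def)
    show "K \<noteq> {}" using sub_closed by (auto simp: K_def)
  next
    fix a assume "a \<in> K"
    then obtain h k where a: "a = h \<otimes> x [^] (k::int)" "h \<in> H" by (auto simp: K_def)
    then have "inv a = inv h \<otimes> x [^] (- k)"
      using x sub_closed by (simp add: inv_mult int_pow_neg)
    then show "inv a \<in> K" using a sub_closed by (auto simp: K_def)
  next
    fix a b assume "a \<in> K" "b \<in> K"
    then obtain h k h' k' where a: "a = h \<otimes> x [^] (k::int)" "h \<in> H" "b = h' \<otimes> x [^] (k'::int)" "h' \<in> H"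
      by (auto simp: K_def)
    then have "a \<otimes> b = (h \<otimes> h') \<otimes> x [^] (k + k')"
      using x sub_closed by (simp add: int_pow_mult m_ac)
    then show "a \<otimes> b \<in> K" using a sub_closed unfolding K_def by blast
  qed
  moreover have "H \<subset> K"
  proof
    show "H \<subseteq> K"
    proof
      fix h assume "h \<in> H"
      then have "h = h \<otimes> x [^] (0::int)" using sub_closed by simp
      then show "h \<in> K" using \<open>h \<in> H\<close> unfolding K_def by blast
    qed
    have "x = \<one> \<otimes> x [^] (1::int)" using x by (simp add: int_pow_1)
    then have "x \<in> K" using sub_closed unfolding K_def by blast
    then show "H \<noteq> K" using x by auto
  qed
  moreover have "finite K" using \<open>subgroup K G\<close> fin by (metis subgroup.subset finite_subset)
  ultimately have K: "K = carrier G"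
    using max[of K] psubset_card_mono[of K H] by fastforce
  define n where "n = (LEAST n. n > 0 \<and> x [^] (n::nat) \<in> H)"
  have "order G > 0" using fin by (simp add: order_gt_0_iff_finite)
  moreover have "x [^] order G \<in> H" using x sub_closed by (simp add: pow_order_eq_1)
  ultimately have n: "n > 0" "x [^] n \<in> H"
    using LeastI[of "\<lambda>n. n > 0 \<and> x [^] (n::nat) \<in> H" "order G"] by (auto simp: n_def)
  have least: "\<not> (0 < j \<and> x [^] j \<in> H)" if "j < n" for j :: nat
    using that not_less_Least unfolding n_def by blast
  have pow_H: "h [^] (k::int) \<in> H" if "h \<in> H" for h k
    using that subgroup_int_pow_closed[OF sub] by blast
  have dvd: "int n dvd k" if k: "x [^] (k::int) \<in> H" for k
  proof -
    have "k mod int n = k + int n * (- (k div int n))"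
      by (simp add: minus_div_mult_eq_mod[symmetric] algebra_simps)
    then have "x [^] (k mod int n) = x [^] k \<otimes> (x [^] int n) [^] (- (k div int n))"
      using x by (metis int_pow_mult int_pow_pow)
    then have "x [^] (k mod int n) \<in> H"
      using k n(2) pow_H sub_closed by (metis int_pow_int)
    moreover have "x [^] (k mod int n) = x [^] nat (k mod int n)"
      using n(1) by (metis int_pow_int pos_mod_sign nat_0_le of_nat_0_less_iff)
    moreover have "nat (k mod int n) < n" using n(1) by (simp add: nat_less_iff)
    ultimately have "nat (k mod int n) = 0" using least by (metis gr0I)
    then have "k mod int n = 0" using n(1) by (metis nat_eq_iff2 pos_mod_sign of_nat_0_less_iff
        nat_0_le of_nat_0)
    then show ?thesis by presburger
  qed
  define e where "e = (\<lambda>k::int. cis (2 * pi * (of_int k / of_nat n)))"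
  have e_add: "e (j + k) = e j * e k" for j k
    by (simp add: e_def cis_mult add_divide_distrib ring_distribs)
  have e_dvd: "e k = 1" if "int n dvd k" for k
  proof -
    have "of_int k / of_nat n = (of_int (k div int n) :: real)"
      using that n(1) by (auto simp: dvd_def)
    then show ?thesis unfolding e_def by (simp only: cis_multiple_2pi Ints_of_int)
  qed
  define \<chi> where "\<chi> = (\<lambda>y. e (SOME k. \<exists>h\<in>H. y = h \<otimes> x [^] (k::int)))"
  have val: "\<chi> (h \<otimes> x [^] (k::int)) = e k" if h: "h \<in> H" for h k
  proof -
    define k' where "k' = (SOME k'. \<exists>h'\<in>H. h \<otimes> x [^] k = h' \<otimes> x [^] (k'::int))"
    have "\<exists>h'\<in>H. h \<otimes> x [^] k = h' \<otimes> x [^] k'"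
      unfolding k'_def by (rule someI[of _ k]) (use h in blast)
    then obtain h' where h': "h' \<in> H" "h \<otimes> x [^] k = h' \<otimes> x [^] k'" by blast
    have hc: "h \<in> carrier G" "h' \<in> carrier G" using h h' sub_closed by auto
    have "x [^] (k - k') = inv h \<otimes> (h \<otimes> x [^] k) \<otimes> inv (x [^] k')"
      using x hc by (simp add: int_pow_diff m_assoc[symmetric])
    also have "\<dots> = inv h \<otimes> h'" using x hc by (simp add: h'(2) m_assoc)
    finally have "x [^] (k - k') \<in> H" using h h' sub_closed by simp
    then have "e (k - k') = 1" by (intro e_dvd dvd)
    then have "e k = e k'" using e_add[of "k - k'" k'] by simp
    then show ?thesis by (simp add: \<chi>_def k'_def)
  qed
  show ?thesis
  proof (intro exI[of _ \<chi>] conjI ballI)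
    fix a b assume "a \<in> carrier G" "b \<in> carrier G"
    then obtain h k h' k' where a: "a = h \<otimes> x [^] (k::int)" "h \<in> H" "b = h' \<otimes> x [^] (k'::int)" "h' \<in> H"
      unfolding K[symmetric] K_def by blast
    then have "a \<otimes> b = (h \<otimes> h') \<otimes> x [^] (k + k')"
      using x sub_closed by (simp add: int_pow_mult m_ac)
    then show "\<chi> (a \<otimes> b) = \<chi> a * \<chi> b" using a sub_closed by (simp add: val e_add)
  next
    fix a show "cmod (\<chi> a) = 1" by (simp add: \<chi>_def e_def)
  next
    have "x = \<one> \<otimes> x [^] (1::int)" using x by (simp add: int_pow_1)
    then have "\<chi> x = e 1" using val[of "\<one>" 1] sub_closed by simp
    moreover have "e 1 \<noteq> 1"
    proof
      assume "e 1 = 1"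
      then have "cos (2 * pi * (1 / of_nat n)) = 1" by (simp add: e_def complex_eq_iff)
      then obtain j :: int where "2 * pi * (1 / of_nat n) = of_int j * 2 * pi"
        using cos_one_2pi_int by blast
      then have "1 * (2 * pi) = real_of_int (j * int n) * (2 * pi)"
        using n(1) by (simp add: field_simps)
      then have "real_of_int (j * int n) = 1" by simp
      then have "j * int n = 1" by linarith
      then have "n = 1" using n(1) by (simp add: zmult_eq_1_iff)
      then show False using n(2) x by simp
    qed
    ultimately show "\<exists>x\<in>carrier G. \<chi> x \<noteq> 1" using x(1) by (intro bexI[of _ x]) simp_all
  qed
qed

locale odd_field_character = odd_finite_field +
  fixes \<chi> :: "'a \<Rightarrow> complex"
  assumes char_add: "x \<in> carrier F \<Longrightarrow> y \<in> carrier F \<Longrightarrow> \<chi> (x \<oplus> y) = \<chi> x * \<chi> y"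
    and char_norm: "x \<in> carrier F \<Longrightarrow> cmod (\<chi> x) = 1"
    and char_nontrivial: "\<exists>x\<in>carrier F. \<chi> x \<noteq> 1"

lemma (in odd_finite_field) exists_character: "\<exists>\<chi>. odd_field_character F \<chi>"
proof -
  have "\<one> \<in> carrier F - {\<zero>}" by simp
  then have "carrier F \<noteq> {\<zero>}" by blast
  then have "carrier (add_monoid F) \<noteq> {\<one>\<^bsub>add_monoid F\<^esub>}" by simp
  then obtain \<chi> :: "'a \<Rightarrow> complex" where "\<forall>x\<in>carrier F. \<forall>y\<in>carrier F. \<chi> (x \<oplus> y) = \<chi> x * \<chi> y"
    "\<forall>x\<in>carrier F. cmod (\<chi> x) = 1" "\<exists>x\<in>carrier F. \<chi> x \<noteq> 1"
    using comm_group.exists_nontrivial_character[OF a_comm_group] finite_carrier by auto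
  then have "odd_field_character F \<chi>" by unfold_locales auto
  then show ?thesis by blast
qed

context odd_field_character
begin

lemma char_cnj: "x \<in> carrier F \<Longrightarrow> \<chi> x * cnj (\<chi> x) = 1"
  using char_norm[of x] by (simp add: complex_norm_square[symmetric])

lemma char_zero: "\<chi> \<zero> = 1"
  using char_add[of \<zero> \<zero>] char_norm[of \<zero>] by auto

section \<open>Fourier analysis on the vector space\<close>

text \<open>For \<open>m \<noteq> m'\<close> the summand is a nontrivial character of the vector space in \<open>z\<close>: it takes the
  value \<open>\<chi> t \<noteq> 1\<close> at a suitable multiple \<open>z0\<close> of a basis vector on which \<open>m\<close> and \<open>m'\<close> differ.
  Translating the sum by \<open>z0\<close> multiplies it by that value, so the sum vanishes.\<close>

lemma character_orthogonality:
  assumes m: "m \<in> vecs F n" and m': "m' \<in> vecs F n"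
  shows "(\<Sum>z\<in>vecs F n. \<chi> (dot F n m z) * cnj (\<chi> (dot F n m' z)))
    = (if m = m' then of_nat (q ^ n) else 0)"
proof (cases "m = m'")
  case True
  then show ?thesis using m by (simp add: char_cnj card_vecs)
next
  case False
  let ?V = "vecs F n"
  let ?f = "\<lambda>z. \<chi> (dot F n m z) * cnj (\<chi> (dot F n m' z))"
  obtain j where j: "j < n" "m j \<noteq> m' j" using False m m' vecs_eqI by blast
  obtain t where t: "t \<in> carrier F" "\<chi> t \<noteq> 1" using char_nontrivial by blast
  have mj: "m j \<in> carrier F" "m' j \<in> carrier F" using m m' j by (auto simp: vecs_nth)
  then have "m j \<ominus> m' j \<in> Units F" using j by (simp add: field_Units)
  then have i: "inv (m j \<ominus> m' j) \<in> carrier F" "inv (m j \<ominus> m' j) \<otimes> (m j \<ominus> m' j) = \<one>" by auto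
  define s where "s = t \<otimes> inv (m j \<ominus> m' j)"
  have s: "s \<in> carrier F" "s \<otimes> (m j \<ominus> m' j) = t"
    using t i mj by (auto simp: s_def m_assoc)
  define z0 where "z0 = smul F n s (unit_vec F n j)"
  have z0: "z0 \<in> ?V" using s by (simp add: z0_def vec_closed)
  have "dot F n m z0 = s \<otimes> m j" "dot F n m' z0 = s \<otimes> m' j"
    using m m' s j by (simp_all add: z0_def dot_smul_right unit_vec_closed dot_unit_vec)
  moreover have "s \<otimes> m j = t \<oplus> s \<otimes> m' j"
    unfolding s(2)[symmetric] using s(1) mj by algebra
  ultimately have "?f z0 = \<chi> t * (\<chi> (s \<otimes> m' j) * cnj (\<chi> (s \<otimes> m' j)))"
    using t s mj by (simp add: char_add)
  then have fz0: "?f z0 \<noteq> 1" using t s mj by (simp add: char_cnj)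
  have shift: "?f (vec_plus F n z0 z) = ?f z0 * ?f z" if "z \<in> ?V" for z
    using that m m' z0 by (simp add: dot_plus_right char_add)
  have "(\<Sum>z\<in>?V. ?f z) = (\<Sum>z\<in>?V. ?f (vec_plus F n z0 z))"
    by (rule sum.reindex_bij_betw[OF bij_betw_vec_plus[OF z0], symmetric])
  also have "\<dots> = ?f z0 * (\<Sum>z\<in>?V. ?f z)"
    unfolding sum_distrib_left by (intro sum.cong refl shift)
  finally have "(1 - ?f z0) * (\<Sum>z\<in>?V. ?f z) = 0" by (simp add: left_diff_distrib)
  then show ?thesis using fz0 False by simp
qed

lemma parseval:
  "(\<Sum>z\<in>vecs F n. (cmod (\<Sum>m\<in>vecs F n. c m * \<chi> (dot F n m z)))\<^sup>2)
    = real (q ^ n) * (\<Sum>m\<in>vecs F n. (cmod (c m))\<^sup>2)"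
proof -
  let ?V = "vecs F n"
  let ?g = "\<lambda>z m m'. (c m * \<chi> (dot F n m z)) * cnj (c m' * \<chi> (dot F n m' z))"
  have "complex_of_real (\<Sum>z\<in>?V. (cmod (\<Sum>m\<in>?V. c m * \<chi> (dot F n m z)))\<^sup>2)
      = (\<Sum>z\<in>?V. \<Sum>m\<in>?V. \<Sum>m'\<in>?V. ?g z m m')"
    unfolding of_real_sum complex_norm_square cnj_sum sum_product by (rule refl)
  also have "\<dots> = (\<Sum>m\<in>?V. \<Sum>z\<in>?V. \<Sum>m'\<in>?V. ?g z m m')" by (rule sum.swap)
  also have "\<dots> = (\<Sum>m\<in>?V. \<Sum>m'\<in>?V. \<Sum>z\<in>?V. ?g z m m')"
    by (rule sum.cong[OF refl sum.swap])
  also have "\<dots> = (\<Sum>m\<in>?V. \<Sum>m'\<in>?V. c m * cnj (c m') *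
      (\<Sum>z\<in>?V. \<chi> (dot F n m z) * cnj (\<chi> (dot F n m' z))))"
    unfolding sum_distrib_left by (intro sum.cong refl) (simp add: mult_ac)
  also have "\<dots> = (\<Sum>m\<in>?V. \<Sum>m'\<in>?V. if m = m' then c m * cnj (c m') * of_nat (q ^ n) else 0)"
    by (intro sum.cong refl) (simp add: character_orthogonality)
  also have "\<dots> = (\<Sum>m\<in>?V. c m * cnj (c m) * of_nat (q ^ n))"
    by (intro sum.cong refl) (simp add: finite_vecs)
  also have "\<dots> = complex_of_real (real (q ^ n) * (\<Sum>m\<in>?V. (cmod (c m))\<^sup>2))"
    unfolding of_real_mult of_real_sum complex_norm_square sum_distrib_left
    by (intro sum.cong refl) simp
  finally show ?thesis unfolding of_real_eq_iff .
qed

definition fourier :: "nat \<Rightarrow> (nat \<Rightarrow> 'a) set \<Rightarrow> (nat \<Rightarrow> 'a) \<Rightarrow> complex" where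
  "fourier n A m = (\<Sum>a\<in>A. \<chi> (dot F n m a))"

text \<open>An instance of \<open>parseval\<close> with the indicator function of \<open>A\<close> as coefficients, and with the roles
  of frequencies and points exchanged, which the symmetry of the dot product permits.\<close>

lemma fourier_parseval:
  assumes A: "A \<subseteq> vecs F n"
  shows "(\<Sum>m\<in>vecs F n. (cmod (fourier n A m))\<^sup>2) = real (q ^ n) * real (card A)"
proof -
  let ?c = "\<lambda>a. if a \<in> A then 1 else 0 :: complex"
  have "fourier n A m = (\<Sum>a\<in>vecs F n. ?c a * \<chi> (dot F n a m))" if m: "m \<in> vecs F n" for m
  proof -
    have "(\<Sum>a\<in>vecs F n. ?c a * \<chi> (dot F n a m)) = (\<Sum>a\<in>A. ?c a * \<chi> (dot F n a m))"
      using A finite_vecs by (intro sum.mono_neutral_right) auto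
    also have "\<dots> = fourier n A m"
      unfolding fourier_def using A m by (intro sum.cong) (auto simp: dot_comm[of m])
    finally show ?thesis by simp
  qed
  then have "(\<Sum>m\<in>vecs F n. (cmod (fourier n A m))\<^sup>2)
      = (\<Sum>m\<in>vecs F n. (cmod (\<Sum>a\<in>vecs F n. ?c a * \<chi> (dot F n a m)))\<^sup>2)"
    by (intro sum.cong) auto
  also have "\<dots> = real (q ^ n) * (\<Sum>a\<in>vecs F n. (cmod (?c a))\<^sup>2)" by (rule parseval)
  also have "(\<Sum>a\<in>vecs F n. (cmod (?c a))\<^sup>2) = (\<Sum>a\<in>A. (cmod (?c a))\<^sup>2)"
    using A finite_vecs by (intro sum.mono_neutral_right) auto
  also have "\<dots> = real (card A)" by simp
  finally show ?thesis .
qed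

lemma fourier_inversion:
  assumes B: "B \<subseteq> vecs F n" and y: "y \<in> vecs F n"
  shows "(\<Sum>m\<in>vecs F n. cnj (fourier n B m) * \<chi> (dot F n m y))
    = (if y \<in> B then of_nat (q ^ n) else 0)"
proof -
  have fB: "finite B" using B finite_vecs finite_subset by blast
  have "(\<Sum>m\<in>vecs F n. cnj (fourier n B m) * \<chi> (dot F n m y))
      = (\<Sum>m\<in>vecs F n. \<Sum>b\<in>B. \<chi> (dot F n m y) * cnj (\<chi> (dot F n m b)))"
    unfolding fourier_def cnj_sum sum_distrib_right by (intro sum.cong refl) (rule mult.commute)
  also have "\<dots> = (\<Sum>b\<in>B. \<Sum>m\<in>vecs F n. \<chi> (dot F n m y) * cnj (\<chi> (dot F n m b)))"
    by (rule sum.swap)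
  also have "\<dots> = (\<Sum>b\<in>B. \<Sum>m\<in>vecs F n. \<chi> (dot F n y m) * cnj (\<chi> (dot F n b m)))"
  proof (intro sum.cong refl)
    fix b m assume "b \<in> B" "m \<in> vecs F n"
    then show "\<chi> (dot F n m y) * cnj (\<chi> (dot F n m b)) = \<chi> (dot F n y m) * cnj (\<chi> (dot F n b m))"
      using dot_comm[of m n y] dot_comm[of m n b] B y by auto
  qed
  also have "\<dots> = (\<Sum>b\<in>B. if y = b then of_nat (q ^ n) else 0)"
    using B by (intro sum.cong refl character_orthogonality y) auto
  also have "\<dots> = (if y \<in> B then of_nat (q ^ n) else 0)" using fB by simp
  finally show ?thesis .
qed

section \<open>The variance of the number of incidences\<close>

text \<open>Expand the indicator function of \<open>B\<close> by Fourier inversion at each of the points \<open>f a + z\<close> and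
  sum over \<open>a\<close>.\<close>

lemma card_incidences_fourier:
  assumes A: "A \<subseteq> vecs F n" and B: "B \<subseteq> vecs F n"
    and f: "f \<in> isometries F n" and z: "z \<in> vecs F n"
  shows "(\<Sum>m\<in>vecs F n. cnj (fourier n B m) * fourier n (f ` A) m * \<chi> (dot F n m z))
    = of_nat (q ^ n * card {a \<in> A. vec_plus F n (f a) z \<in> B})"
proof -
  let ?V = "vecs F n"
  have fA: "finite A" using A finite_vecs finite_subset by blast
  have Vf: "f a \<in> ?V" if "a \<in> A" for a using that A f by (auto simp: isometry_closed)
  have "inj_on f A" using A isometry_bij[OF f] by (metis bij_betw_def inj_on_subset)
  then have four: "fourier n (f ` A) m = (\<Sum>a\<in>A. \<chi> (dot F n m (f a)))" for m
    unfolding fourier_def by (simp add: sum.reindex)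
  have "(\<Sum>m\<in>?V. cnj (fourier n B m) * fourier n (f ` A) m * \<chi> (dot F n m z))
      = (\<Sum>m\<in>?V. \<Sum>a\<in>A. cnj (fourier n B m) * \<chi> (dot F n m (vec_plus F n (f a) z)))"
  proof (intro sum.cong refl)
    fix m assume m: "m \<in> ?V"
    have "\<chi> (dot F n m (vec_plus F n (f a) z)) = \<chi> (dot F n m (f a)) * \<chi> (dot F n m z)"
      if "a \<in> A" for a
      using m z Vf[OF that] by (simp add: dot_plus_right char_add)
    then show "cnj (fourier n B m) * fourier n (f ` A) m * \<chi> (dot F n m z)
        = (\<Sum>a\<in>A. cnj (fourier n B m) * \<chi> (dot F n m (vec_plus F n (f a) z)))"
      by (simp add: four sum_distrib_left sum_distrib_right mult.assoc)
  qed
  also have "\<dots> = (\<Sum>a\<in>A. \<Sum>m\<in>?V. cnj (fourier n B m) * \<chi> (dot F n m (vec_plus F n (f a) z)))"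
    by (rule sum.swap)
  also have "\<dots> = (\<Sum>a\<in>A. if vec_plus F n (f a) z \<in> B then of_nat (q ^ n) else 0)"
    using z Vf by (intro sum.cong refl fourier_inversion B vec_plus_closed)
  also have "\<dots> = of_nat (q ^ n * card {a \<in> A. vec_plus F n (f a) z \<in> B})"
    using fA by (simp add: sum.If_cases Int_def mult.commute)
  finally show ?thesis .
qed

lemma fourier_zero: "A \<subseteq> vecs F n \<Longrightarrow> fourier n A (zero_vec F n) = of_nat (card A)"
  unfolding fourier_def by (simp add: dot_zero_left char_zero subset_iff)

lemma fourier_isometry:
  assumes A: "A \<subseteq> vecs F n" and f: "f \<in> isometries F n" and m: "m \<in> vecs F n"
  shows "fourier n (f ` A) (f m) = fourier n A m"
proof -
  have "inj_on f A" using A isometry_bij[OF f] by (metis bij_betw_def inj_on_subset)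
  then have "fourier n (f ` A) (f m) = (\<Sum>a\<in>A. \<chi> (dot F n (f m) (f a)))"
    unfolding fourier_def by (simp add: sum.reindex)
  also have "\<dots> = fourier n A m"
    unfolding fourier_def using A m f by (intro sum.cong refl) (auto simp: isometry_dot subset_iff)
  finally show ?thesis .
qed

text \<open>The frequency 0 contributes \<open>|A| |B|\<close>, the mean up to the factor \<open>q^n\<close> by which both terms
  are scaled, so the deviation from the mean has the remaining frequencies as its Fourier
  expansion.  After Parseval, the substitution of \<open>f m\<close> for \<open>m\<close> removes \<open>f\<close> from the coefficient
  of \<open>A\<close>.\<close>

lemma incidence_variance_fixed_isometry:
  assumes A: "A \<subseteq> vecs F n" and B: "B \<subseteq> vecs F n" and f: "f \<in> isometries F n"
  shows "(\<Sum>z\<in>vecs F n. (real (q ^ n * card {a \<in> A. vec_plus F n (f a) z \<in> B})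
        - real (card A) * real (card B))\<^sup>2)
    = real (q ^ n) * (\<Sum>m\<in>vecs F n - {zero_vec F n}.
        (cmod (fourier n B (f m)))\<^sup>2 * (cmod (fourier n A m))\<^sup>2)"
proof -
  let ?V = "vecs F n" and ?o = "zero_vec F n"
  define c where "c = (\<lambda>m. if m = ?o then 0 else cnj (fourier n B m) * fourier n (f ` A) m)"
  have fA: "f ` A \<subseteq> ?V" using A f by (auto simp: isometry_closed)
  have inj: "inj_on f ?V" using isometry_bij[OF f] by (simp add: bij_betw_def)
  have cA: "card (f ` A) = card A" using A inj by (metis card_image inj_on_subset)
  have z: "(real (q ^ n * card {a \<in> A. vec_plus F n (f a) z \<in> B}) - real (card A) * real (card B))\<^sup>2
      = (cmod (\<Sum>m\<in>?V. c m * \<chi> (dot F n m z)))\<^sup>2" if z: "z \<in> ?V" for z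
  proof -
    let ?g = "\<lambda>m. cnj (fourier n B m) * fourier n (f ` A) m * \<chi> (dot F n m z)"
    have "(\<Sum>m\<in>?V. c m * \<chi> (dot F n m z)) = (\<Sum>m\<in>?V - {?o}. c m * \<chi> (dot F n m z))"
      using finite_vecs by (intro sum.mono_neutral_right) (auto simp: c_def)
    also have "\<dots> = (\<Sum>m\<in>?V - {?o}. ?g m)" by (intro sum.cong) (auto simp: c_def)
    also have "\<dots> = (\<Sum>m\<in>?V. ?g m) - ?g ?o"
      using finite_vecs zero_vec_closed by (simp add: sum_diff1)
    also have "?g ?o = of_nat (card A * card B)"
      using fourier_zero[OF B] fourier_zero[OF fA] z by (simp add: dot_zero_left char_zero cA)
    also have "(\<Sum>m\<in>?V. ?g m) = of_nat (q ^ n * card {a \<in> A. vec_plus F n (f a) z \<in> B})"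
      by (rule card_incidences_fourier[OF A B f z])
    finally have "(\<Sum>m\<in>?V. c m * \<chi> (dot F n m z)) = complex_of_real
      (real (q ^ n * card {a \<in> A. vec_plus F n (f a) z \<in> B}) - real (card A) * real (card B))"
      by simp
    then show ?thesis by (simp only: norm_of_real power2_abs)
  qed
  have "(\<Sum>z\<in>?V. (real (q ^ n * card {a \<in> A. vec_plus F n (f a) z \<in> B}) - real (card A) * real (card B))\<^sup>2)
      = (\<Sum>z\<in>?V. (cmod (\<Sum>m\<in>?V. c m * \<chi> (dot F n m z)))\<^sup>2)"
    by (intro sum.cong refl z)
  also have "\<dots> = real (q ^ n) * (\<Sum>m\<in>?V. (cmod (c m))\<^sup>2)" by (rule parseval)
  also have "(\<Sum>m\<in>?V. (cmod (c m))\<^sup>2) = (\<Sum>m\<in>?V. (cmod (c (f m)))\<^sup>2)"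
    by (rule sum.reindex_bij_betw[OF isometry_bij[OF f], symmetric])
  also have "\<dots> = (\<Sum>m\<in>?V - {?o}. (cmod (c (f m)))\<^sup>2)"
    using finite_vecs by (intro sum.mono_neutral_right) (auto simp: c_def isometry_zero[OF f])
  also have "\<dots> = (\<Sum>m\<in>?V - {?o}. (cmod (fourier n B (f m)))\<^sup>2 * (cmod (fourier n A m))\<^sup>2)"
  proof (intro sum.cong refl)
    fix m assume m: "m \<in> ?V - {?o}"
    then have "f m \<noteq> ?o"
      using isometry_zero[OF f] inj zero_vec_closed by (metis DiffD1 DiffD2 inj_onD singletonI)
    then show "(cmod (c (f m)))\<^sup>2 = (cmod (fourier n B (f m)))\<^sup>2 * (cmod (fourier n A m))\<^sup>2"
      using m fourier_isometry[OF A f] by (simp add: c_def norm_mult power_mult_distrib)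
  qed
  finally show ?thesis .
qed

text \<open>In the sum over \<open>f\<close> of the previous identity, group the isometries by the image of \<open>m\<close>.  Every
  \<open>w\<close> is hit at most \<open>K\<close> times, so the factor belonging to \<open>B\<close> is at most \<open>K\<close> times the full sum
  of its squared coefficients, whatever \<open>m\<close> is.\<close>

lemma incidence_variance_le:
  assumes A: "A \<subseteq> vecs F n" and B: "B \<subseteq> vecs F n"
    and K: "\<And>m w. m \<in> vecs F n \<Longrightarrow> m \<noteq> zero_vec F n \<Longrightarrow> card {f \<in> isometries F n. f m = w} \<le> K"
  shows "(\<Sum>f\<in>isometries F n. \<Sum>z\<in>vecs F n.
      (real (q ^ n * card {a \<in> A. vec_plus F n (f a) z \<in> B}) - real (card A) * real (card B))\<^sup>2)
    \<le> real (q ^ n) ^ 3 * real K * real (card A) * real (card B)"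
proof -
  let ?V = "vecs F n" and ?o = "zero_vec F n" and ?I = "isometries F n"
  let ?\<alpha> = "\<lambda>m. (cmod (fourier n A m))\<^sup>2" and ?\<beta> = "\<lambda>m. (cmod (fourier n B m))\<^sup>2"
  have fibre: "(\<Sum>f\<in>?I. ?\<beta> (f m)) \<le> real K * (\<Sum>w\<in>?V. ?\<beta> w)" if m: "m \<in> ?V" "m \<noteq> ?o" for m
  proof -
    have "(\<Sum>f\<in>?I. ?\<beta> (f m)) = (\<Sum>w\<in>?V. \<Sum>f\<in>{f \<in> ?I. f m = w}. ?\<beta> (f m))"
      using m by (intro sum.group[symmetric] finite_isometries finite_vecs) (auto simp: isometry_closed)
    also have "\<dots> = (\<Sum>w\<in>?V. real (card {f \<in> ?I. f m = w}) * ?\<beta> w)"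
      by (intro sum.cong refl) simp
    also have "\<dots> \<le> (\<Sum>w\<in>?V. real K * ?\<beta> w)"
      using K[OF m] by (intro sum_mono mult_right_mono) auto
    finally show ?thesis by (simp add: sum_distrib_left)
  qed
  have "(\<Sum>f\<in>?I. \<Sum>m\<in>?V - {?o}. ?\<beta> (f m) * ?\<alpha> m)
      = (\<Sum>m\<in>?V - {?o}. (\<Sum>f\<in>?I. ?\<beta> (f m)) * ?\<alpha> m)"
    unfolding sum_distrib_right by (rule sum.swap)
  also have "\<dots> \<le> (\<Sum>m\<in>?V - {?o}. (real K * (\<Sum>w\<in>?V. ?\<beta> w)) * ?\<alpha> m)"
    using fibre by (intro sum_mono mult_right_mono) auto
  also have "\<dots> \<le> (\<Sum>m\<in>?V. (real K * (\<Sum>w\<in>?V. ?\<beta> w)) * ?\<alpha> m)"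
    using finite_vecs by (intro sum_mono2) (auto intro!: mult_nonneg_nonneg sum_nonneg)
  also have "\<dots> = (real K * (\<Sum>w\<in>?V. ?\<beta> w)) * (\<Sum>m\<in>?V. ?\<alpha> m)"
    by (rule sum_distrib_left[symmetric])
  also have "\<dots> = real K * (real (q ^ n) * real (card B)) * (real (q ^ n) * real (card A))"
    by (simp only: fourier_parseval[OF A] fourier_parseval[OF B])
  finally have bound: "(\<Sum>f\<in>?I. \<Sum>m\<in>?V - {?o}. ?\<beta> (f m) * ?\<alpha> m)
      \<le> real K * (real (q ^ n) * real (card B)) * (real (q ^ n) * real (card A))" .
  have "(\<Sum>f\<in>?I. \<Sum>z\<in>?V.
      (real (q ^ n * card {a \<in> A. vec_plus F n (f a) z \<in> B}) - real (card A) * real (card B))\<^sup>2)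
      = (\<Sum>f\<in>?I. real (q ^ n) * (\<Sum>m\<in>?V - {?o}. ?\<beta> (f m) * ?\<alpha> m))"
    by (intro sum.cong refl incidence_variance_fixed_isometry A B)
  also have "\<dots> = real (q ^ n) * (\<Sum>f\<in>?I. \<Sum>m\<in>?V - {?o}. ?\<beta> (f m) * ?\<alpha> m)"
    by (rule sum_distrib_left[symmetric])
  also have "\<dots> \<le> real (q ^ n) * (real K * (real (q ^ n) * real (card B)) * (real (q ^ n) * real (card A)))"
    by (rule mult_left_mono[OF bound]) simp
  also have "\<dots> = real (q ^ n) ^ 3 * real K * real (card A) * real (card B)"
    by (simp add: power3_eq_cube)
  finally show ?thesis .
qed

end

section \<open>The union of the images\<close>

context odd_finite_field
begin

text \<open>Only the part of the variance that comes from the motions in \<open>R\<close> is kept.  There the number of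
  incidences is \<open>|A|\<close>, so each motion contributes \<open>(q^n |A| - |A| |B|)^2\<close>, and \<open>q^n - |B|\<close> is at
  least \<open>q^n / 2\<close>; the square of this one half is the factor 4.\<close>

lemma card_rigid_images_ge:
  assumes A: "A \<subseteq> vecs F n" and R: "R \<subseteq> rigid_motions F n"
    and K: "\<And>m w. m \<in> vecs F n \<Longrightarrow> m \<noteq> zero_vec F n \<Longrightarrow> card {f \<in> isometries F n. f m = w} \<le> K"
    and small: "2 * real (card (\<Union>r\<in>R. rigid_map F n r ` A)) < real (q ^ n)"
  shows "real (card A) * real (card R) \<le> 4 * real (q ^ n) * real K * real (card (\<Union>r\<in>R. rigid_map F n r ` A))"
proof -
  obtain \<chi> where "odd_field_character F \<chi>" using exists_character by blast
  then interpret odd_field_character F \<chi> .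
  let ?V = "vecs F n" and ?I = "isometries F n"
  let ?B = "\<Union>r\<in>R. rigid_map F n r ` A"
  let ?Q = "real (q ^ n)" and ?a = "real (card A)" and ?b = "real (card ?B)"
  let ?D = "\<lambda>f z. (real (q ^ n * card {a \<in> A. vec_plus F n (f a) z \<in> ?B}) - ?a * ?b)\<^sup>2"
  \<comment> \<open>Distinct motions give distinct pairs of an isometry and a translation.\<close>
  let ?\<iota> = "\<lambda>(g, z). (restrict (mat_vec F n g) ?V, z)"
  have Q: "?Q > 0" using q_ge_3 by simp
  have orth_mats: "g \<in> mats F n" if "g \<in> orth F n" for g using that by (simp add: orth_def)
  have B: "?B \<subseteq> ?V"
    using A R by (auto simp: rigid_map_def rigid_motions_def orth_mats subset_iff intro!: vec_plus_closed mat_vec_closed)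
  have \<iota>: "?\<iota> ` R \<subseteq> ?I \<times> ?V"
    using R by (auto simp: rigid_motions_def intro!: orth_isometry)
  have inj: "inj_on ?\<iota> R"
  proof (rule inj_onI)
    fix r s assume rs: "r \<in> R" "s \<in> R" "?\<iota> r = ?\<iota> s"
    obtain g z h w where [simp]: "r = (g, z)" "s = (h, w)" by (cases r, cases s)
    have "g \<in> orth F n" "h \<in> orth F n" using rs R by (auto simp: rigid_motions_def)
    then show "r = s" using rs orth_isometry_inj[of n] by (auto dest: inj_onD)
  qed
  have val: "?D (fst (?\<iota> r)) (snd (?\<iota> r)) = (?Q * ?a - ?a * ?b)\<^sup>2" if r: "r \<in> R" for r
  proof -
    obtain g z where [simp]: "r = (g, z)" by (cases r)
    have "vec_plus F n (restrict (mat_vec F n g) ?V a) z \<in> ?B" if "a \<in> A" for a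
      using that r A by (force simp: rigid_map_def subset_iff)
    then have "{a \<in> A. vec_plus F n (restrict (mat_vec F n g) ?V a) z \<in> ?B} = A" by blast
    then show ?thesis by simp
  qed
  have "real (card R) * (?Q * ?a - ?a * ?b)\<^sup>2 = (\<Sum>r\<in>R. ?D (fst (?\<iota> r)) (snd (?\<iota> r)))"
    using val by simp
  also have "\<dots> = (\<Sum>p\<in>?\<iota> ` R. ?D (fst p) (snd p))" by (simp add: sum.reindex[OF inj])
  also have "\<dots> \<le> (\<Sum>p\<in>?I \<times> ?V. ?D (fst p) (snd p))"
    using \<iota> finite_isometries finite_vecs by (intro sum_mono2) auto
  also have "\<dots> = (\<Sum>f\<in>?I. \<Sum>z\<in>?V. ?D f z)"
    by (simp add: sum.cartesian_product split_def)
  also have "\<dots> \<le> ?Q ^ 3 * real K * ?a * ?b"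
    by (rule incidence_variance_le[OF A B K])
  finally have main: "real (card R) * (?Q * ?a - ?a * ?b)\<^sup>2 \<le> ?Q ^ 3 * real K * ?a * ?b" .
  show ?thesis
  proof (cases "card A = 0")
    case True
    then show ?thesis by simp
  next
    case False
    then have a: "?a > 0" by simp
    have "?Q / 2 \<le> ?Q - ?b" using small by simp
    then have "(?Q / 2)\<^sup>2 \<le> (?Q - ?b)\<^sup>2" using Q by (intro power_mono) auto
    then have "real (card R) * ?a\<^sup>2 * (?Q / 2)\<^sup>2 \<le> real (card R) * ?a\<^sup>2 * (?Q - ?b)\<^sup>2"
      by (intro mult_left_mono) auto
    also have "\<dots> = real (card R) * (?Q * ?a - ?a * ?b)\<^sup>2"
      by (simp add: power2_eq_square algebra_simps)
    also note main
    finally have "(?a * ?Q\<^sup>2) * (?a * real (card R)) \<le> (?a * ?Q\<^sup>2) * (4 * ?Q * real K * ?b)"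
      by (simp add: power2_eq_square power3_eq_cube field_simps)
    then show ?thesis using a Q by (subst (asm) mult_le_cancel_left_pos) auto
  qed
qed

text \<open>The two counts of isometries meet in \<open>\<Prod>k<n - 1. q ^ k\<close>.  Each dimension loses a factor 2 in
  the upper bound, for the two points of a quadric on a line, and a factor 3 in the lower bound,
  for the excluded reflections.\<close>

lemma card_transport_le_orth:
  assumes "m \<in> vecs F n" "m \<noteq> zero_vec F n"
  shows "card {f \<in> isometries F n. f m = w} \<le> 6 ^ (n - 1) * card (orth F (n - 1))"
proof -
  have "card {f \<in> isometries F n. f m = w} \<le> (\<Prod>k<n - 1. 2 * q ^ k)"
    using assms by (intro card_isometries_transport_le nonzero_vec_nth)
  also have "\<dots> = 2 ^ (n - 1) * (\<Prod>k<n - 1. q ^ k)" by (simp add: prod.distrib)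
  also have "\<dots> \<le> 2 ^ (n - 1) * (3 ^ (n - 1) * card (orth F (n - 1)))"
  proof -
    have "(\<Prod>k<n - 1. q ^ k) \<le> 3 ^ (n - 1) * card (isometries F (n - 1))" by (rule card_isometries_ge)
    also have "\<dots> \<le> 3 ^ (n - 1) * card (orth F (n - 1))"
      by (rule mult_le_mono2[OF card_isometries_le_orth])
    finally show ?thesis by (rule mult_le_mono2)
  qed
  also have "\<dots> = 6 ^ (n - 1) * card (orth F (n - 1))"
    using power_mult_distrib[of "2 :: nat" 3 "n - 1"] by simp
  finally show ?thesis .
qed

lemma card_orth_pos: "card (orth F n) > 0"
proof -
  have "0 < (\<Prod>k<n. q ^ k)" using q_ge_3 by (intro prod_pos) auto
  also have "\<dots> \<le> 3 ^ n * card (orth F n)"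
    using card_isometries_ge card_isometries_le_orth by (meson le_trans mult_le_mono2)
  finally show ?thesis by simp
qed

lemma card_rigid_images_ge_min:
  assumes A: "A \<subseteq> vecs F n" and R: "R \<subseteq> rigid_motions F n"
  shows "real (card (\<Union>r\<in>R. rigid_map F n r ` A)) \<ge> 1 / (4 * 6 ^ (n - 1)) *
    min (real q ^ n) (real (card A) * real (card R) / (real q ^ n * real (card (orth F (n - 1)))))"
    (is "real (card ?B) \<ge> ?c * min ?Q (?P / (?Q * ?O))")
proof (cases "2 * real (card ?B) < real (q ^ n)")
  case True
  have Q: "?Q > 0" "?O > 0" using q_ge_3 card_orth_pos by auto
  have "?P \<le> 4 * real (q ^ n) * real (6 ^ (n - 1) * card (orth F (n - 1))) * real (card ?B)"
    by (rule card_rigid_images_ge[OF A R card_transport_le_orth True])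
  then have "?c * (?P / (?Q * ?O)) \<le> real (card ?B)"
    using Q by (simp add: field_simps)
  moreover have "?c * min ?Q (?P / (?Q * ?O)) \<le> ?c * (?P / (?Q * ?O))"
    by (intro mult_left_mono) auto
  ultimately show ?thesis by linarith
next
  case False
  have "(2::real) \<le> 4 * 6 ^ (n - 1)" using one_le_power[of "6::real" "n - 1"] by linarith
  then have "?c \<le> 1 / 2" by (intro divide_left_mono) simp_all
  have "?c * min ?Q (?P / (?Q * ?O)) \<le> ?c * ?Q" by (intro mult_left_mono) auto
  also have "\<dots> \<le> 1 / 2 * ?Q" using \<open>?c \<le> 1 / 2\<close> by (intro mult_right_mono) auto
  also have "\<dots> \<le> real (card ?B)" using False by simp
  finally show ?thesis .
qed

end

(* The constant must not depend on the field, so the field is quantified after it, hence over a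
   fixed carrier type.  Every finite field is isomorphic to one whose carrier is a finite set of
   natural numbers; q is then automatically a prime power.
   The order q is taken odd: for q even every orthogonal g preserves the functional
   x_1 + ... + x_d (its square is x . x), and the inequality fails. *)
theorem theorem1p9:
  fixes d :: nat
  assumes "d \<ge> 2"
  shows "\<exists>c::real. c > 0 \<and>
    (\<forall>(q::nat) (F :: nat ring) A R.
       field F \<and> finite (carrier F) \<and> card (carrier F) = q \<and> odd q \<and>
       A \<subseteq> vecs F d \<and> R \<subseteq> rigid_motions F d \<longrightarrow>
       real (card (\<Union>r\<in>R. rigid_map F d r ` A))
         \<ge> c * min (real q ^ d)
                   (real (card A) * real (card R) / (real q ^ d * real (card (orth F (d - 1))))))"
proof (intro exI[of _ "1 / (4 * 6 ^ (d - 1))"] conjI allI impI)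
  show "0 < 1 / (4 * 6 ^ (d - 1) :: real)" by simp
next
  fix q :: nat and F :: "nat ring" and A R
  assume *: "field F \<and> finite (carrier F) \<and> card (carrier F) = q \<and> odd q \<and>
    A \<subseteq> vecs F d \<and> R \<subseteq> rigid_motions F d"
  then interpret odd_finite_field F
    by (intro odd_finite_field.intro odd_finite_field_axioms.intro) auto
  show "real (card (\<Union>r\<in>R. rigid_map F d r ` A))
      \<ge> 1 / (4 * 6 ^ (d - 1)) * min (real q ^ d)
          (real (card A) * real (card R) / (real q ^ d * real (card (orth F (d - 1)))))"
    using card_rigid_images_ge_min[of A d R] * by auto
qed

end
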